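(* Let $n\ge 2$, let $G$ be a relation graph, let $T(L)$ be a $G$-realization, and let $T(R)\in\mathcal{B}_G(T(L))$. Then the set $$\mathcal{N}_G(T(R)):=\{\,T(S)\in\mathcal{B}_G(T(L)) \mid E^+_{G(R)}\subseteq E^+_{G(S)}\,\}$$ is a basis of the $U(\mathfrak{gl}(n))$-submodule $U(\mathfrak{gl}(n))\cdot T(R)$ of $V_G(T(L))$ generated by $T(R)$.
   Context: Fix $n\ge2$. $\mathfrak{gl}(n)$ is the Lie algebra of $n\times n$ complex matrices with matrix units $E_{ij}$, and $U(\mathfrak{gl}(n))$ is its universal enveloping algebra. Let $\mathfrak{V}=\{(i,j) : 1\le j\le i\le n\}$; the vertices $(k,1),\dots,(k,k)$ form row $k$, and row $n$ is the top row (row $k+1$ is drawn above row $k$). All graphs are directed graphs with vertex set $\mathfrak{V}$. Tableaux. For $L=(l_{ij})_{(i,j)\in\mathfrak{V}}\in\mathbb{C}^{n(n+1)/2}$, $T(L)$ denotes the Gelfand--Tsetlin tableau with entry $l_{ij}$ at position $(i,j)$. Let $\delta^{ki}$ be the vector with entry $1$ at position $(k,i)$ and $0$ elsewhere. Let $\mathbb{Z}_0^{n(n+1)/2}$ be the set of $w\in\mathbb{Z}^{n(n+1)/2}$ with $w_{n,i}=0$ for all $1\le i\le n$. Relation graphs. For $1\le i<j\le k\le n-1$, $((k,i),(k,j))$ is an adjoining pair of vertices in $G$ if there is a directed path in $G$ from $(k,i)$ to $(k,j)$ and, whenever $i<t<j$, there are no directed paths from $(k,i)$ to $(k,t)$ or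 from $(k,t)$ to $(k,j)$. $G$ is a relation graph if: (i) the only possible arrows of $G$ connect vertices in consecutive rows or vertices in the $n$-th row; (ii) for $1\le k\le n$ and $1\le i<j\le k$ there is no directed path from $(k,j)$ to $(k,i)$; (iii) $G$ has no oriented cycles and no multiple arrows; (iv) for any two vertices in the same row $k<n$ and in the same connected component of the unoriented graph associated to $G$, there is an oriented path in $G$ from one of them to the other; (v) $G$ does not contain a subgraph consisting of two arrows $(k+1,r)\to(k,j)$ and $(k+1,s)\to(k,i)$ with $1\le r<s\le k+1$ and $1\le i<j\le k$; (vi) for every adjoining pair $((k,i),(k,j))$, $G$ contains either the four arrows $(k,i)\to(k+1,p)$, $(k+1,p)\to(k,j)$, $(k,i)\to(k-1,q)$, $(k-1,q)\to(k,j)$ for some $1\le p\le k+1$, $1\le q\le k-1$, or the two arrows $(k,i)\to(k+1,s)$, $(k+1,t)\to(k,j)$ for some $1\le s<t\le k+1$. Realizations. $T(L)$ satisfies $G$ if for every arrow of $G$ from $(i,j)$ to $(r,s)$: $l_{ij}-l_{rs}\in\mathbb{Z}_{\ge0}$ if the arrow is horizontal or points down (i.e. $i=r$ or $i=r+1$), and $l_{ij}-l_{rs}\in\mathbb{Z}_{>0}$ if the arrow points up ($i=r-1$). $T(L)$ is a $G$-realization if it satisfies $G$ and, for every $1\le k\le n-1$, $l_{ki}-l_{kj}\in\mathbb{Z}$ only if $(k,i)$ and $(k,j)$ are in the same connected component of the unoriented graph associated to $G$. For a $G$-realization $T(L)$, $\mathcal{B}_G(T(L))$ is the set of all $G$-realizations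 of the form $T(L+z)$ with $z\in\mathbb{Z}_0^{n(n+1)/2}$. The module. For a relation graph $G$ and a $G$-realization $T(L)$, $V_G(T(L))$ is the complex vector space with basis $\mathcal{B}_G(T(L))$. It is a known theorem that it is a $\mathfrak{gl}(n)$-module under the Gelfand--Tsetlin formulas $$E_{k,k+1}T(L)=-\sum_{i=1}^{k}\frac{\prod_{j=1}^{k+1}(l_{ki}-l_{k+1,j})}{\prod_{j\ne i}(l_{ki}-l_{kj})}T(L+\delta^{ki}),\qquad E_{k+1,k}T(L)=\sum_{i=1}^{k}\frac{\prod_{j=1}^{k-1}(l_{ki}-l_{k-1,j})}{\prod_{j\ne i}(l_{ki}-l_{kj})}T(L-\delta^{ki}),$$ $$E_{kk}T(L)=\Bigl(k-1+\sum_{i=1}^{k}l_{ki}-\sum_{i=1}^{k-1}l_{k-1,i}\Bigr)T(L)$$ (applied to every basis tableau; the products over $j\neq i$ run over $1\le j\le k$; terms whose tableau is not in $\mathcal{B}_G(T(L))$ are zero). The graph $G(L)$. For any tableau $T(L)$, $G(L)$ is the graph with vertex set $\mathfrak{V}$ and an arrow from $(i,j)$ to $(r,s)$ if: $i=r+1$ and $l_{ij}-l_{rs}\in\mathbb{Z}_{\ge0}$; or $i=r-1$ and $l_{ij}-l_{rs}\in\mathbb{Z}_{>0}$; or $i=r=n$, $j<s$ and $l_{ij}-l_{rs}\in\mathbb{Z}_{\ge0}$. For a graph $H$, $E_H^+$ is the set of arrows of $H$ pointing down, i.e. from a vertex of row $k$ to a vertex of row $k-1$. *)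

theory Defs
  imports Complex_Main "HOL-Library.Poly_Mapping"
begin

section \<open>The complex vector space on a set of symbols\<close>

text \<open>\<^typ>\<open>'a \<Rightarrow>\<^sub>0 complex\<close> is the space of formal finite complex linear combinations of
  elements of \<^typ>\<open>'a\<close>.\<close>

definition cscale :: "complex \<Rightarrow> ('a \<Rightarrow>\<^sub>0 complex) \<Rightarrow> ('a \<Rightarrow>\<^sub>0 complex)"
  where "cscale c v = Poly_Mapping.map ((*) c) v"

lemma lookup_cscale [simp]:
  "Poly_Mapping.lookup (cscale c v) x = c * Poly_Mapping.lookup v x"
  by (simp add: cscale_def map.rep_eq when_def)

interpretation cvec: vector_space "cscale :: complex \<Rightarrow> ('a \<Rightarrow>\<^sub>0 complex) \<Rightarrow> ('a \<Rightarrow>\<^sub>0 complex)"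
  by unfold_locales (rule poly_mapping_eqI, simp add: lookup_add algebra_simps)+

definition basis_vec :: "'a \<Rightarrow> ('a \<Rightarrow>\<^sub>0 complex)"
  where "basis_vec x = Poly_Mapping.single x 1"

definition lin_ext :: "('a \<Rightarrow> ('b \<Rightarrow>\<^sub>0 complex)) \<Rightarrow> ('a \<Rightarrow>\<^sub>0 complex) \<Rightarrow> ('b \<Rightarrow>\<^sub>0 complex)"
  where "lin_ext f v = (\<Sum>x\<in>Poly_Mapping.keys v. cscale (Poly_Mapping.lookup v x) (f x))"

section \<open>Tableaux and relation graphs\<close>

type_synonym vertex = "nat \<times> nat"
type_synonym digraph = "(vertex \<times> vertex) set"
type_synonym tableau = "vertex \<Rightarrow> complex"

definition verts :: "nat \<Rightarrow> vertex set"
  where "verts n = {(i, j). 1 \<le> j \<and> j \<le> i \<and> i \<le> n}"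

text \<open>Tableaux vanish off \<^term>\<open>verts n\<close>, so that a tableau is determined by its
  \<open>n(n+1)/2\<close> entries.\<close>

definition tableaux :: "nat \<Rightarrow> tableau set"
  where "tableaux n = {L. \<forall>v. v \<notin> verts n \<longrightarrow> L v = 0}"

definition same_component :: "digraph \<Rightarrow> vertex \<Rightarrow> vertex \<Rightarrow> bool"
  where "same_component G u v \<longleftrightarrow> (u, v) \<in> (G \<union> G\<inverse>)\<^sup>*"

definition adjoining_pair :: "nat \<Rightarrow> digraph \<Rightarrow> nat \<Rightarrow> nat \<Rightarrow> nat \<Rightarrow> bool"
  where "adjoining_pair n G k i j \<longleftrightarrow>
    1 \<le> i \<and> i < j \<and> j \<le> k \<and> k \<le> n - 1 \<and>
    ((k, i), (k, j)) \<in> G\<^sup>+ \<and>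
    (\<forall>t. i < t \<and> t < j \<longrightarrow> ((k, i), (k, t)) \<notin> G\<^sup>+ \<and> ((k, t), (k, j)) \<notin> G\<^sup>+)"

text \<open>A graph is its set of arrows, so it has no multiple arrows by construction.  All arrows
  lie between elements of \<^term>\<open>verts n\<close>, so the index ranges in the last two
  conditions need not be repeated.\<close>

definition relation_graph :: "nat \<Rightarrow> digraph \<Rightarrow> bool"
  where "relation_graph n G \<longleftrightarrow>
    G \<subseteq> verts n \<times> verts n \<and>
    (\<forall>i j r s. ((i, j), (r, s)) \<in> G \<longrightarrow> i = r + 1 \<or> r = i + 1 \<or> i = n \<and> r = n) \<and>
    (\<forall>k i j. 1 \<le> k \<and> k \<le> n \<and> 1 \<le> i \<and> i < j \<and> j \<le> k \<longrightarrow> ((k, j), (k, i)) \<notin> G\<^sup>+) \<and>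
    acyclic G \<and>
    (\<forall>k i j. 1 \<le> k \<and> k < n \<and> i \<in> {1..k} \<and> j \<in> {1..k} \<and> same_component G (k, i) (k, j) \<longrightarrow>
       ((k, i), (k, j)) \<in> G\<^sup>* \<or> ((k, j), (k, i)) \<in> G\<^sup>*) \<and>
    \<not> (\<exists>k r s i j. r < s \<and> i < j \<and>
         ((k + 1, r), (k, j)) \<in> G \<and> ((k + 1, s), (k, i)) \<in> G) \<and>
    (\<forall>k i j. adjoining_pair n G k i j \<longrightarrow>
       (\<exists>p q. {((k, i), (k + 1, p)), ((k + 1, p), (k, j)),
               ((k, i), (k - 1, q)), ((k - 1, q), (k, j))} \<subseteq> G) \<or>
       (\<exists>s t. s < t \<and> {((k, i), (k + 1, s)), ((k + 1, t), (k, j))} \<subseteq> G))"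

definition satisfies :: "digraph \<Rightarrow> tableau \<Rightarrow> bool"
  where "satisfies G L \<longleftrightarrow> (\<forall>i j r s. ((i, j), (r, s)) \<in> G \<longrightarrow>
    (i = r \<or> i = r + 1 \<longrightarrow> L (i, j) - L (r, s) \<in> \<nat>) \<and>
    (r = i + 1 \<longrightarrow> L (i, j) - L (r, s) \<in> \<nat> - {0}))"

definition realization :: "nat \<Rightarrow> digraph \<Rightarrow> tableau \<Rightarrow> bool"
  where "realization n G L \<longleftrightarrow>
    L \<in> tableaux n \<and> satisfies G L \<and>
    (\<forall>k i j. 1 \<le> k \<and> k \<le> n - 1 \<and> i \<in> {1..k} \<and> j \<in> {1..k} \<and> L (k, i) - L (k, j) \<in> \<int> \<longrightarrow>
       same_component G (k, i) (k, j))"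

definition shifts :: "nat \<Rightarrow> (vertex \<Rightarrow> int) set"
  where "shifts n = {z. (\<forall>v. v \<notin> verts n \<longrightarrow> z v = 0) \<and> (\<forall>i. z (n, i) = 0)}"

definition real_basis :: "nat \<Rightarrow> digraph \<Rightarrow> tableau \<Rightarrow> tableau set"
  where "real_basis n G L =
    {T. realization n G T \<and> (\<exists>z\<in>shifts n. T = (\<lambda>v. L v + of_int (z v)))}"

section \<open>The Gelfand--Tsetlin formulas\<close>

text \<open>Throughout, \<open>B\<close> is the set of basis tableaux; tableaux that are not in \<open>B\<close> count as zero.\<close>

definition tab_term :: "tableau set \<Rightarrow> complex \<Rightarrow> tableau \<Rightarrow> (tableau \<Rightarrow>\<^sub>0 complex)"
  where "tab_term B c T = (if T \<in> B then cscale c (basis_vec T) else 0)"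

definition gt_raise :: "tableau set \<Rightarrow> nat \<Rightarrow> (tableau \<Rightarrow>\<^sub>0 complex) \<Rightarrow> (tableau \<Rightarrow>\<^sub>0 complex)"
  where "gt_raise B k = lin_ext (\<lambda>L. - (\<Sum>i = 1..k. tab_term B
     ((\<Prod>j = 1..k + 1. L (k, i) - L (k + 1, j)) / (\<Prod>j\<in>{1..k} - {i}. L (k, i) - L (k, j)))
     (L((k, i) := L (k, i) + 1))))"

definition gt_lower :: "tableau set \<Rightarrow> nat \<Rightarrow> (tableau \<Rightarrow>\<^sub>0 complex) \<Rightarrow> (tableau \<Rightarrow>\<^sub>0 complex)"
  where "gt_lower B k = lin_ext (\<lambda>L. \<Sum>i = 1..k. tab_term B
     ((\<Prod>j = 1..k - 1. L (k, i) - L (k - 1, j)) / (\<Prod>j\<in>{1..k} - {i}. L (k, i) - L (k, j)))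
     (L((k, i) := L (k, i) - 1)))"

definition gt_diag :: "tableau set \<Rightarrow> nat \<Rightarrow> (tableau \<Rightarrow>\<^sub>0 complex) \<Rightarrow> (tableau \<Rightarrow>\<^sub>0 complex)"
  where "gt_diag B k = lin_ext (\<lambda>L. tab_term B
     (of_nat k - 1 + (\<Sum>i = 1..k. L (k, i)) - (\<Sum>i = 1..k - 1. L (k - 1, i))) L)"

text \<open>The formulas give the action of \<open>E\<^sub>k\<^sub>,\<^sub>k\<^sub>+\<^sub>1\<close>, \<open>E\<^sub>k\<^sub>+\<^sub>1\<^sub>,\<^sub>k\<close> and \<open>E\<^sub>k\<^sub>k\<close>; the remaining
  matrix units act by the iterated commutators
  \<open>E\<^sub>i\<^sub>,\<^sub>j\<^sub>+\<^sub>1 = [E\<^sub>i\<^sub>j, E\<^sub>j\<^sub>,\<^sub>j\<^sub>+\<^sub>1]\<close> for \<open>i < j\<close> and \<open>E\<^sub>i\<^sub>+\<^sub>1\<^sub>,\<^sub>j = [E\<^sub>i\<^sub>+\<^sub>1\<^sub>,\<^sub>i, E\<^sub>i\<^sub>j]\<close> for \<open>i > j\<close>,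
  which is forced by the Lie algebra structure.  Below, \<open>gt_above B i d\<close> is the action of
  \<open>E\<^sub>i\<^sub>,\<^sub>i\<^sub>+\<^sub>d\<^sub>+\<^sub>1\<close> and \<open>gt_below B j d\<close> that of \<open>E\<^sub>j\<^sub>+\<^sub>d\<^sub>+\<^sub>1\<^sub>,\<^sub>j\<close>.\<close>

primrec gt_above :: "tableau set \<Rightarrow> nat \<Rightarrow> nat \<Rightarrow> (tableau \<Rightarrow>\<^sub>0 complex) \<Rightarrow> (tableau \<Rightarrow>\<^sub>0 complex)"
  where
    "gt_above B i 0 = gt_raise B i"
  | "gt_above B i (Suc d) = (\<lambda>v.
       gt_above B i d (gt_raise B (i + d + 1) v) - gt_raise B (i + d + 1) (gt_above B i d v))"

primrec gt_below :: "tableau set \<Rightarrow> nat \<Rightarrow> nat \<Rightarrow> (tableau \<Rightarrow>\<^sub>0 complex) \<Rightarrow> (tableau \<Rightarrow>\<^sub>0 complex)"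
  where
    "gt_below B j 0 = gt_lower B j"
  | "gt_below B j (Suc d) = (\<lambda>v.
       gt_lower B (j + d + 1) (gt_below B j d v) - gt_below B j d (gt_lower B (j + d + 1) v))"

definition gt_E :: "tableau set \<Rightarrow> nat \<Rightarrow> nat \<Rightarrow> (tableau \<Rightarrow>\<^sub>0 complex) \<Rightarrow> (tableau \<Rightarrow>\<^sub>0 complex)"
  where "gt_E B i j =
    (if i = j then gt_diag B i
     else if i < j then gt_above B i (j - i - 1)
     else gt_below B j (i - j - 1))"

section \<open>The universal enveloping algebra and its action\<close>

text \<open>The tensor algebra of \<open>\<gg>\<ll>(n)\<close> is the free associative algebra on the matrix units:
  linear combinations of words in letters \<open>(i, j)\<close>, standing for \<open>E\<^sub>i\<^sub>j\<close>.\<close>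

definition mat_units :: "nat \<Rightarrow> (nat \<times> nat) set"
  where "mat_units n = {1..n} \<times> {1..n}"

definition tensor_alg :: "nat \<Rightarrow> ((nat \<times> nat) list \<Rightarrow>\<^sub>0 complex) set"
  where "tensor_alg n = {a. Poly_Mapping.keys a \<subseteq> lists (mat_units n)}"

text \<open>The two-sided ideal generated by the elements \<open>x \<otimes> y - y \<otimes> x - [x, y]\<close>, where
  \<open>[E\<^sub>i\<^sub>j, E\<^sub>k\<^sub>l] = \<delta>\<^sub>j\<^sub>k E\<^sub>i\<^sub>l - \<delta>\<^sub>l\<^sub>i E\<^sub>k\<^sub>j\<close>.\<close>

definition uea_ideal :: "nat \<Rightarrow> ((nat \<times> nat) list \<Rightarrow>\<^sub>0 complex) set"
  where "uea_ideal n = cvec.span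
    {basis_vec (u @ [(i, j), (k, l)] @ w) - basis_vec (u @ [(k, l), (i, j)] @ w)
       - ((if j = k then basis_vec (u @ [(i, l)] @ w) else 0)
          - (if l = i then basis_vec (u @ [(k, j)] @ w) else 0))
     | u w i j k l. u \<in> lists (mat_units n) \<and> w \<in> lists (mat_units n) \<and>
         (i, j) \<in> mat_units n \<and> (k, l) \<in> mat_units n}"

definition uea :: "nat \<Rightarrow> ((nat \<times> nat) list \<Rightarrow>\<^sub>0 complex) set set"
  where "uea n = tensor_alg n //
    {(a, b). a \<in> tensor_alg n \<and> b \<in> tensor_alg n \<and> a - b \<in> uea_ideal n}"

definition tensor_act ::
    "tableau set \<Rightarrow> ((nat \<times> nat) list \<Rightarrow>\<^sub>0 complex) \<Rightarrow> (tableau \<Rightarrow>\<^sub>0 complex) \<Rightarrow> (tableau \<Rightarrow>\<^sub>0 complex)"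
  where "tensor_act B a v = lin_ext (\<lambda>w. foldr (\<lambda>(i, j). gt_E B i j) w v) a"

text \<open>The set of all \<open>u v\<close> with \<open>u\<close> in the enveloping algebra.  A class acts through its
  representatives; that all of them act alike on the span of \<^term>\<open>real_basis n G L\<close> is the
  statement that the Gelfand--Tsetlin formulas define a module.\<close>

definition uea_submodule ::
    "nat \<Rightarrow> tableau set \<Rightarrow> (tableau \<Rightarrow>\<^sub>0 complex) \<Rightarrow> (tableau \<Rightarrow>\<^sub>0 complex) set"
  where "uea_submodule n B v = {tensor_act B a v | a u. u \<in> uea n \<and> a \<in> u}"

text \<open>This set is indeed the submodule generated by \<open>v\<close>: the least subspace containing
  \<open>v\<close> and stable under the Lie algebra.\<close>

definition gl_stable :: "nat \<Rightarrow> tableau set \<Rightarrow> (tableau \<Rightarrow>\<^sub>0 complex) set \<Rightarrow> bool"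
  where "gl_stable n B W \<longleftrightarrow> cvec.subspace W \<and>
    (\<forall>i\<in>{1..n}. \<forall>j\<in>{1..n}. gt_E B i j ` W \<subseteq> W)"

lemma lin_ext_superset:
  assumes "finite A" "Poly_Mapping.keys v \<subseteq> A"
  shows "lin_ext f v = (\<Sum>x\<in>A. cscale (Poly_Mapping.lookup v x) (f x))"
  unfolding lin_ext_def
  by (rule sum.mono_neutral_left) (use assms in \<open>auto simp: in_keys_iff\<close>)

lemma lin_ext_add: "lin_ext f (v + w) = lin_ext f v + lin_ext f w"
proof -
  let ?A = "Poly_Mapping.keys v \<union> Poly_Mapping.keys w"
  have "Poly_Mapping.keys (v + w) \<subseteq> ?A" by (rule keys_add)
  then show ?thesis
    by (simp add: lin_ext_superset[where A = ?A] lookup_add cvec.scale_left_distrib sum.distrib)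
qed

lemma lin_ext_scale: "lin_ext f (cscale c v) = cscale c (lin_ext f v)"
proof -
  have "Poly_Mapping.keys (cscale c v) \<subseteq> Poly_Mapping.keys v" by (auto simp: in_keys_iff)
  then show ?thesis
    by (simp add: lin_ext_superset[where A = "Poly_Mapping.keys v"] cvec.scale_sum_right)
qed

lemma lin_ext_basis_vec [simp]: "lin_ext f (basis_vec x) = f x"
  by (simp add: lin_ext_def basis_vec_def)

lemma linear_lin_ext: "Vector_Spaces.linear cscale cscale (lin_ext f)"
  by (unfold_locales) (auto simp: lin_ext_add lin_ext_scale)

lemma linear_diff_comp:
  assumes "Vector_Spaces.linear cscale cscale f" "Vector_Spaces.linear cscale cscale g"
  shows "Vector_Spaces.linear cscale cscale (\<lambda>v. f (g v) - g (f v))"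
proof -
  interpret f: Vector_Spaces.linear cscale cscale f by fact
  interpret g: Vector_Spaces.linear cscale cscale g by fact
  show ?thesis
    by unfold_locales (simp_all add: f.add g.add f.scale g.scale cvec.scale_right_diff_distrib)
qed

lemma linear_gt_above: "Vector_Spaces.linear cscale cscale (gt_above B i d)"
  by (induction d) (simp_all add: gt_raise_def linear_lin_ext linear_diff_comp)

lemma linear_gt_below: "Vector_Spaces.linear cscale cscale (gt_below B i d)"
  by (induction d) (simp_all add: gt_lower_def linear_lin_ext linear_diff_comp)

lemma linear_gt_E: "Vector_Spaces.linear cscale cscale (gt_E B i j)"
  by (auto simp: gt_E_def gt_diag_def linear_lin_ext linear_gt_above linear_gt_below)

lemma uea_submodule_alt: "uea_submodule n B v = (\<lambda>a. tensor_act B a v) ` tensor_alg n"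
proof
  show "uea_submodule n B v \<subseteq> (\<lambda>a. tensor_act B a v) ` tensor_alg n"
    by (auto simp: uea_submodule_def uea_def quotient_def)
  have "a \<in> {(a, b). a \<in> tensor_alg n \<and> b \<in> tensor_alg n \<and> a - b \<in> uea_ideal n} `` {a}"
    if "a \<in> tensor_alg n" for a
    using that by (auto simp: uea_ideal_def cvec.span_zero)
  then show "(\<lambda>a. tensor_act B a v) ` tensor_alg n \<subseteq> uea_submodule n B v"
    unfolding uea_submodule_def uea_def by (fastforce intro: quotientI)
qed

lemma word_stable:
  assumes "gl_stable n B W" "v \<in> W" "w \<in> lists (mat_units n)"
  shows "foldr (\<lambda>(i, j). gt_E B i j) w v \<in> W"
  using assms(3)
proof (induction w)
  case Nil
  then show ?case using assms(2) by simp
next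
  case (Cons x w)
  obtain i j where x: "x = (i, j)" by fastforce
  have "i \<in> {1..n}" "j \<in> {1..n}" using Cons.hyps x by (auto simp: mat_units_def)
  then have "gt_E B i j ` W \<subseteq> W" using assms(1) unfolding gl_stable_def by blast
  then show ?case using Cons.IH x by auto
qed

lemma tensor_act_stable:
  assumes "gl_stable n B W" "v \<in> W" "a \<in> tensor_alg n"
  shows "tensor_act B a v \<in> W"
  unfolding tensor_act_def lin_ext_def
  using assms by (intro cvec.subspace_sum cvec.subspace_scale word_stable[of n])
    (auto simp: gl_stable_def tensor_alg_def)

lemma uea_submodule_eq_span: 
  "uea_submodule n B v = cvec.span ((\<lambda>w. foldr (\<lambda>(i, j). gt_E B i j) w v) ` lists (mat_units n))"
  (is "_ = cvec.span (?f ` ?Ls)")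
proof
  show "uea_submodule n B v \<subseteq> cvec.span (?f ` ?Ls)"
  proof
    fix x assume "x \<in> uea_submodule n B v"
    then obtain a where a: "Poly_Mapping.keys a \<subseteq> ?Ls" "x = tensor_act B a v"
      by (auto simp: uea_submodule_alt tensor_alg_def)
    show "x \<in> cvec.span (?f ` ?Ls)"
      unfolding a(2) tensor_act_def lin_ext_def
      by (intro cvec.span_sum cvec.span_scale cvec.span_base imageI) (use a(1) in blast)
  qed
  have sub: "cvec.subspace (tensor_alg n :: ((nat \<times> nat) list \<Rightarrow>\<^sub>0 complex) set)"
    unfolding tensor_alg_def
  proof (rule cvec.subspaceI)
    fix x y :: "(nat \<times> nat) list \<Rightarrow>\<^sub>0 complex"
    assume "x \<in> {a. Poly_Mapping.keys a \<subseteq> lists (mat_units n)}"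
      and "y \<in> {a. Poly_Mapping.keys a \<subseteq> lists (mat_units n)}"
    then show "x + y \<in> {a. Poly_Mapping.keys a \<subseteq> lists (mat_units n)}"
      using keys_add[of x y] by blast
  next
    fix c and x :: "(nat \<times> nat) list \<Rightarrow>\<^sub>0 complex"
    assume x: "x \<in> {a. Poly_Mapping.keys a \<subseteq> lists (mat_units n)}"
    have "Poly_Mapping.keys (cscale c x) \<subseteq> Poly_Mapping.keys x"
      by (auto simp del: in_listsI simp: in_keys_iff)
    with x show "cscale c x \<in> {a. Poly_Mapping.keys a \<subseteq> lists (mat_units n)}"
      by blast
  qed simp
  interpret l: Vector_Spaces.linear cscale cscale "\<lambda>a. tensor_act B a v"
    unfolding tensor_act_def by (rule linear_lin_ext)
  have "cvec.subspace (uea_submodule n B v)"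
    unfolding uea_submodule_alt using sub by (rule l.subspace_image)
  moreover have "?f ` ?Ls \<subseteq> uea_submodule n B v"
  proof (rule image_subsetI)
    fix w assume "w \<in> ?Ls"
    then have "basis_vec w \<in> tensor_alg n" by (auto simp: tensor_alg_def basis_vec_def)
    moreover have "tensor_act B (basis_vec w) v = ?f w" by (simp add: tensor_act_def)
    ultimately show "?f w \<in> uea_submodule n B v" unfolding uea_submodule_alt by (metis imageI)
  qed
  ultimately show "cvec.span (?f ` ?Ls) \<subseteq> uea_submodule n B v" by (rule cvec.span_minimal[rotated])
qed

lemma uea_submodule_least:
  "uea_submodule n B v = \<Inter>{W. gl_stable n B W \<and> v \<in> W}"
proof
  show "uea_submodule n B v \<subseteq> \<Inter>{W. gl_stable n B W \<and> v \<in> W}"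
    unfolding uea_submodule_alt by (auto intro: tensor_act_stable)
  let ?f = "\<lambda>w. foldr (\<lambda>(i, j). gt_E B i j) w v"
  have "gt_E B i j ` uea_submodule n B v \<subseteq> uea_submodule n B v" if "i \<in> {1..n}" "j \<in> {1..n}" for i j
  proof -
    interpret l: Vector_Spaces.linear cscale cscale "gt_E B i j" by (rule linear_gt_E)
    have "gt_E B i j (?f w) = ?f ((i, j) # w)" for w by simp
    then have "gt_E B i j ` ?f ` lists (mat_units n) \<subseteq> ?f ` lists (mat_units n)"
      using that unfolding image_image
      by (smt (verit, ccfv_threshold) Cons_in_lists_iff SigmaI imageE imageI mat_units_def subsetI)
    then show ?thesis unfolding uea_submodule_eq_span l.span_image[symmetric] by (rule cvec.span_mono)
  qed
  moreover have "v = ?f []" by simp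
  then have "v \<in> uea_submodule n B v" unfolding uea_submodule_eq_span
    by (metis cvec.span_base imageI lists.Nil)
  ultimately show "\<Inter>{W. gl_stable n B W \<and> v \<in> W} \<subseteq> uea_submodule n B v"
    by (auto simp: gl_stable_def uea_submodule_eq_span)
qed

section \<open>The set of tableaux attached to a realization\<close>

definition tab_graph :: "nat \<Rightarrow> tableau \<Rightarrow> digraph"
  where "tab_graph n L = {((i, j), (r, s)). (i, j) \<in> verts n \<and> (r, s) \<in> verts n \<and>
    (i = r + 1 \<and> L (i, j) - L (r, s) \<in> \<nat> \<or>
     r = i + 1 \<and> L (i, j) - L (r, s) \<in> \<nat> - {0} \<or>
     i = n \<and> r = n \<and> j < s \<and> L (i, j) - L (r, s) \<in> \<nat>)}"

definition down_arrows :: "digraph \<Rightarrow> digraph"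
  where "down_arrows H = {((i, j), (r, s)) \<in> H. i = r + 1}"

definition gen_tableaux :: "nat \<Rightarrow> digraph \<Rightarrow> tableau \<Rightarrow> tableau \<Rightarrow> tableau set"
  where "gen_tableaux n G L R =
    {S \<in> real_basis n G L. down_arrows (tab_graph n R) \<subseteq> down_arrows (tab_graph n S)}"

end

theory Submission
  imports Defs "HOL-Computational_Algebra.Polynomial"
begin

text \<open>
  Write \<open>l\<^sub>k\<^sub>i\<close> for the entries of a tableau.  The operators of the enveloping algebra are generated
  by the raising operators \<open>E\<^sub>k\<^sub>,\<^sub>k\<^sub>+\<^sub>1\<close>, the lowering operators \<open>E\<^sub>k\<^sub>+\<^sub>1\<^sub>,\<^sub>k\<close> and the diagonal ones, so the
  generated submodule is the least subspace that contains \<open>T(R)\<close> and is stable under these.  Three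
  facts identify it.

  \<^item> A step \<open>T(S) \<rightarrow> T(S \<plusminus> \<delta>\<^sup>k\<^sup>i)\<close> that would destroy a downward arrow of \<open>G(S)\<close> has coefficient zero:
    a factor of the numerator is the difference at that arrow.  Hence the span of the tableaux
    with \<open>E\<^sup>+(R) \<subseteq> E\<^sup>+(S)\<close> is stable (\<open>down_subset_shift\<close>, \<open>gl_stable_gen_tableaux\<close>).

  \<^item> A stable subspace \<open>W\<close> of the module is spanned by tableaux: it contains the part of each of its vectors that
    is supported on the tableaux with prescribed rows \<open>1, \<dots>, k\<close>, for every \<open>k < n\<close>
    (\<open>stable_splits\<close>).  This goes by induction on \<open>k\<close>.  Row 1 is the eigenvalue of \<open>E\<^sub>1\<^sub>1\<close>.  Once
    the rows up to \<open>k\<close> are separated, one can raise or lower the single entry \<open>l\<^sub>k\<^sub>i\<close>, project, and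
    return.  Each such loop is a diagonal operator on \<open>W\<close>, and its eigenvalue determines the value
    of \<open>A\<^sub>k\<^sub>+\<^sub>1(u) A\<^sub>k\<^sub>-\<^sub>1(u + 1)\<close> at \<open>u = l\<^sub>k\<^sub>i\<close> or \<open>u = l\<^sub>k\<^sub>i - 1\<close>, where \<open>A\<^sub>m(u) = \<Prod>\<^sub>j (u - l\<^sub>m\<^sub>j)\<close>.  The
    polynomial \<open>A\<^sub>k\<^sub>-\<^sub>1\<close> is known, and counting shows that at least \<open>k + 1\<close> values of the monic
    polynomial \<open>A\<^sub>k\<^sub>+\<^sub>1\<close> of degree \<open>k + 1\<close> are determined (\<open>loops_separate\<close>).  Entries of row \<open>k\<close> that
    differ by one give loops without information, and there the condition on adjoining pairs
    supplies a root of \<open>A\<^sub>k\<^sub>+\<^sub>1\<close> (\<open>squeezed_entries\<close>).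

  \<^item> If \<open>E\<^sup>+(R) \<subseteq> E\<^sup>+(S)\<close>, then a chain of steps with nonzero coefficients leads from \<open>R\<close> to \<open>S\<close> and
    moves every entry monotonically.  Whatever blocks an entry from moving towards its value in
    \<open>S\<close> is another entry that has to move at least as far in the same direction and that is
    further along in the order given by \<open>2 l\<^sub>k\<^sub>i + k\<close>, so an extremal entry can always move
    (\<open>step_towards\<close>).
\<close>

section \<open>Coordinate subspaces and diagonal operators\<close>

abbreviation supp :: "('a \<Rightarrow>\<^sub>0 complex) \<Rightarrow> 'a set"
  where "supp v \<equiv> Poly_Mapping.keys v"

definition diag_op :: "('a \<Rightarrow> complex) \<Rightarrow> ('a \<Rightarrow>\<^sub>0 complex) \<Rightarrow> ('a \<Rightarrow>\<^sub>0 complex)"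
  where "diag_op c = lin_ext (\<lambda>x. cscale (c x) (basis_vec x))"

abbreviation restrict_to :: "('a \<Rightarrow> bool) \<Rightarrow> ('a \<Rightarrow>\<^sub>0 complex) \<Rightarrow> ('a \<Rightarrow>\<^sub>0 complex)"
  where "restrict_to P \<equiv> diag_op (\<lambda>x. of_bool (P x))"

lemma lookup_basis_vec: "Poly_Mapping.lookup (basis_vec x) y = of_bool (x = y)"
  by (simp add: basis_vec_def lookup_single when_def)

lemma supp_basis_vec [simp]: "supp (basis_vec x) = {x}"
  by (simp add: basis_vec_def)

lemma lookup_diag_op [simp]:
  "Poly_Mapping.lookup (diag_op c v) x = c x * Poly_Mapping.lookup v x"
proof -
  have "Poly_Mapping.lookup (diag_op c v) x =
      (\<Sum>y\<in>supp v. if y = x then c x * Poly_Mapping.lookup v x else 0)"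
    unfolding diag_op_def lin_ext_def lookup_sum
    by (rule sum.cong) (auto simp: lookup_basis_vec)
  then show ?thesis by (auto simp: in_keys_iff)
qed

lemma supp_restrict_to: "supp (restrict_to P v) = {x \<in> supp v. P x}"
  by (auto simp: in_keys_iff)

lemma lin_ext_cong:
  assumes "\<And>x. x \<in> supp v \<Longrightarrow> f x = g x"
  shows "lin_ext f v = lin_ext g v"
  unfolding lin_ext_def using assms by (intro sum.cong) auto

lemma linear_lin_ext_comp:
  assumes "Vector_Spaces.linear cscale cscale h"
  shows "h (lin_ext f v) = lin_ext (\<lambda>x. h (f x)) v"
proof -
  interpret h: Vector_Spaces.linear cscale cscale h by fact
  show ?thesis unfolding lin_ext_def by (simp add: h.sum h.scale)
qed

lemma linear_diag_op: "Vector_Spaces.linear cscale cscale (diag_op c)"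
  unfolding diag_op_def by (rule linear_lin_ext)

lemma lin_ext_in_subspace:
  assumes "cvec.subspace W" "\<And>x. x \<in> supp v \<Longrightarrow> f x \<in> W"
  shows "lin_ext f v \<in> W"
  unfolding lin_ext_def using assms by (intro cvec.subspace_sum cvec.subspace_scale) auto

lemma lin_ext_basis_vec_id: "lin_ext basis_vec v = v"
proof (rule poly_mapping_eqI)
  fix x
  have "lin_ext basis_vec v = diag_op (\<lambda>_. 1) v" by (simp add: diag_op_def)
  then show "Poly_Mapping.lookup (lin_ext basis_vec v) x = Poly_Mapping.lookup v x" by simp
qed

lemma subspace_supp: "cvec.subspace {v :: 'a \<Rightarrow>\<^sub>0 complex. supp v \<subseteq> A}"
proof (rule cvec.subspaceI)
  fix x y :: "'a \<Rightarrow>\<^sub>0 complex"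
  assume "x \<in> {v. supp v \<subseteq> A}" "y \<in> {v. supp v \<subseteq> A}"
  then show "x + y \<in> {v. supp v \<subseteq> A}" using keys_add[of x y] by blast
next
  fix c and x :: "'a \<Rightarrow>\<^sub>0 complex"
  assume "x \<in> {v. supp v \<subseteq> A}"
  then show "cscale c x \<in> {v. supp v \<subseteq> A}" by (auto simp: in_keys_iff)
qed simp

lemma span_basis_vec: "cvec.span (basis_vec ` A) = {v. supp v \<subseteq> A}"
proof
  show "cvec.span (basis_vec ` A) \<subseteq> {v. supp v \<subseteq> A}"
    by (rule cvec.span_minimal) (auto simp: subspace_supp)
  show "{v. supp v \<subseteq> A} \<subseteq> cvec.span (basis_vec ` A)"
  proof clarify
    fix v :: "'a \<Rightarrow>\<^sub>0 complex" assume "supp v \<subseteq> A"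
    then have "lin_ext basis_vec v \<in> cvec.span (basis_vec ` A)"
      by (intro lin_ext_in_subspace cvec.subspace_span cvec.span_base) auto
    then show "v \<in> cvec.span (basis_vec ` A)" by (simp add: lin_ext_basis_vec_id)
  qed
qed

lemma inj_basis_vec: "inj basis_vec"
  by (rule injI) (metis supp_basis_vec singleton_inject)

lemma independent_basis_vec: "cvec.independent (basis_vec ` A)"
proof
  assume "cvec.dependent (basis_vec ` A)"
  then obtain x where "basis_vec x \<in> cvec.span (basis_vec ` A - {basis_vec x})"
    by (auto simp: cvec.dependent_def)
  also have "basis_vec ` A - {basis_vec x} = basis_vec ` (A - {x})"
    using inj_basis_vec by (auto dest: injD)
  finally show False by (simp add: span_basis_vec)
qed

text \<open>Lagrange interpolation for commuting diagonal operators: the finitely many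
  other points of the support are killed one at a time, each by a factor \<open>c - c Y\<close> of some
  operator that tells \<open>Y\<close> from \<open>T\<close>.\<close>

lemma restrict_to_joint_eigenspace:
  assumes W: "cvec.subspace W" and C: "\<And>c w. c \<in> C \<Longrightarrow> w \<in> W \<Longrightarrow> diag_op c w \<in> W"
    and v: "v \<in> W"
  shows "restrict_to (\<lambda>X. \<forall>c\<in>C. c X = c T) v \<in> W"
proof -
  let ?P = "\<lambda>X. \<forall>c\<in>C. c X = c T"
  have "\<exists>g. diag_op g v \<in> W \<and> (\<forall>X. ?P X \<longrightarrow> g X = 1) \<and> (\<forall>X\<in>A. g X = 0)"
    if "finite A" "\<forall>X\<in>A. \<not> ?P X" for A
    using that
  proof (induction A)
    case empty
    have "diag_op (\<lambda>_. 1) v = v" by (rule poly_mapping_eqI) simp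
    then show ?case using v by (intro exI[of _ "\<lambda>_. 1"]) auto
  next
    case (insert Y A)
    then obtain g where g: "diag_op g v \<in> W" "\<forall>X. ?P X \<longrightarrow> g X = 1" "\<forall>X\<in>A. g X = 0"
      by auto
    obtain c where c: "c \<in> C" "c Y \<noteq> c T" using insert.prems by auto
    let ?g = "\<lambda>X. (c X - c Y) / (c T - c Y) * g X"
    have "diag_op ?g v =
        cscale (1 / (c T - c Y)) (diag_op c (diag_op g v) - cscale (c Y) (diag_op g v))"
      by (rule poly_mapping_eqI) (simp add: lookup_minus diff_divide_distrib algebra_simps)
    also have "\<dots> \<in> W"
      using C[OF c(1) g(1)] g(1) W by (intro cvec.subspace_scale cvec.subspace_diff)
    finally have "diag_op ?g v \<in> W" .
    moreover have "\<forall>X. ?P X \<longrightarrow> ?g X = 1" using g(2) c by auto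
    moreover have "\<forall>X\<in>insert Y A. ?g X = 0" using g(3) by auto
    ultimately show ?case by (intro exI[of _ ?g] conjI)
  qed
  from this[of "{X \<in> supp v. \<not> ?P X}"] obtain g where g: "diag_op g v \<in> W"
    "\<forall>X. ?P X \<longrightarrow> g X = 1" "\<forall>X\<in>{X \<in> supp v. \<not> ?P X}. g X = 0"
    by auto
  have "diag_op g v = restrict_to ?P v"
    by (rule poly_mapping_eqI) (use g(2,3) in \<open>auto simp: in_keys_iff\<close>)
  with g(1) show ?thesis by simp
qed

section \<open>Single steps of the Gelfand--Tsetlin formulas\<close>

definition shift :: "vertex \<Rightarrow> int \<Rightarrow> tableau \<Rightarrow> tableau"
  where "shift v e X = X(v := X v + of_int e)"

text \<open>Raising (\<open>e = 1\<close>) and lowering (\<open>e = -1\<close>) are treated together: \<open>step_coeff e k i X\<close> is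
  the coefficient with which \<open>X\<close> is sent to \<open>X + e \<delta>\<^sup>k\<^sup>i\<close>.\<close>

definition step_coeff :: "int \<Rightarrow> nat \<Rightarrow> nat \<Rightarrow> tableau \<Rightarrow> complex"
  where "step_coeff e k i X =
    (if e = 1 then - (\<Prod>j = 1..k + 1. X (k, i) - X (k + 1, j))
     else (\<Prod>j = 1..k - 1. X (k, i) - X (k - 1, j))) /
    (\<Prod>j\<in>{1..k} - {i}. X (k, i) - X (k, j))"

definition gt_step :: "tableau set \<Rightarrow> int \<Rightarrow> nat \<Rightarrow> (tableau \<Rightarrow>\<^sub>0 complex) \<Rightarrow> (tableau \<Rightarrow>\<^sub>0 complex)"
  where "gt_step B e k =
    lin_ext (\<lambda>X. \<Sum>i = 1..k. tab_term B (step_coeff e k i X) (shift (k, i) e X))"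

lemma tab_term_uminus: "tab_term B (- c) T = - tab_term B c T"
  by (simp add: tab_term_def)

lemma gt_raise_eq_step: "gt_raise B k = gt_step B 1 k"
  by (simp add: gt_raise_def gt_step_def step_coeff_def shift_def tab_term_uminus sum_negf)

lemma gt_lower_eq_step: "gt_lower B k = gt_step B (- 1) k"
  by (simp add: gt_lower_def gt_step_def step_coeff_def shift_def)

text \<open>All other matrix units act by iterated commutators of raising or of lowering operators.\<close>

lemma gl_stable_iff:
  "gl_stable n B W \<longleftrightarrow> cvec.subspace W \<and>
    (\<forall>e\<in>{1, -1}. \<forall>k. 1 \<le> k \<and> k < n \<longrightarrow> gt_step B e k ` W \<subseteq> W) \<and>
    (\<forall>k. 1 \<le> k \<and> k \<le> n \<longrightarrow> gt_diag B k ` W \<subseteq> W)" (is "_ \<longleftrightarrow> ?R")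
proof
  assume L: "gl_stable n B W"
  have E: "gt_E B i j ` W \<subseteq> W" if "i \<in> {1..n}" "j \<in> {1..n}" for i j
    using L that unfolding gl_stable_def by blast
  have "gt_step B e k ` W \<subseteq> W" if e: "e \<in> {1, -1}" and k: "1 \<le> k" "k < n" for e k
  proof -
    have "gt_step B 1 k = gt_E B k (k + 1)" "gt_step B (- 1) k = gt_E B (k + 1) k"
      by (simp_all add: gt_E_def gt_raise_eq_step gt_lower_eq_step)
    then show ?thesis using e k E[of k "k + 1"] E[of "k + 1" k] by auto
  qed
  moreover have "gt_diag B k ` W \<subseteq> W" if k: "1 \<le> k" "k \<le> n" for k
    using E[of k k] k by (simp add: gt_E_def)
  ultimately show ?R using L by (auto simp: gl_stable_def)
next
  assume R: ?R
  then have W: "cvec.subspace W" by simp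
  have st: "gt_step B e k v \<in> W" if "e \<in> {1, -1}" "1 \<le> k" "k < n" "v \<in> W" for e k v
    using R that by blast
  have above: "gt_above B i d v \<in> W" if "1 \<le> i" "i + d < n" "v \<in> W" for i d v
    using that
  proof (induction d arbitrary: v)
    case (Suc d)
    then show ?case
      using st[of 1 "i + d + 1"] by (auto simp: gt_raise_eq_step intro!: cvec.subspace_diff[OF W])
  qed (auto simp: gt_raise_eq_step intro: st)
  have below: "gt_below B i d v \<in> W" if "1 \<le> i" "i + d < n" "v \<in> W" for i d v
    using that
  proof (induction d arbitrary: v)
    case (Suc d)
    then show ?case
      using st[of "-1" "i + d + 1"] by (auto simp: gt_lower_eq_step intro!: cvec.subspace_diff[OF W])
  qed (auto simp: gt_lower_eq_step intro: st)
  have "gt_E B i j v \<in> W" if "i \<in> {1..n}" "j \<in> {1..n}" "v \<in> W" for i j v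
  proof -
    consider "i = j" | "i < j" | "j < i" by linarith
    then show ?thesis
    proof cases
      case 1
      then have "gt_E B i j = gt_diag B i" "1 \<le> i" "i \<le> n" using that by (auto simp: gt_E_def)
      then show ?thesis using R that(3) by fastforce
    next
      case 2
      then show ?thesis using above[of i "j - i - 1" v] that by (simp add: gt_E_def)
    next
      case 3
      then show ?thesis using below[of j "i - j - 1" v] that by (simp add: gt_E_def)
    qed
  qed
  then show "gl_stable n B W" using W unfolding gl_stable_def by blast
qed

lemma gl_stable_Int:
  assumes "gl_stable n B V" "gl_stable n B W"
  shows "gl_stable n B (V \<inter> W)"
  using assms unfolding gl_stable_def by (blast intro: cvec.subspace_inter)

definition agree :: "nat \<Rightarrow> tableau \<Rightarrow> tableau \<Rightarrow> bool"
  where "agree k T X \<longleftrightarrow> (\<forall>r j. r \<le> k \<longrightarrow> X (r, j) = T (r, j))"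

lemma shift_shift_minus [simp]: "shift v (- e) (shift v e X) = X"
  by (auto simp: shift_def)

lemma agree_shift:
  assumes "agree k T X" "e \<noteq> 0"
  shows "agree k (shift (k, i) e T) (shift (k, j) e X) \<longleftrightarrow> i = j"
proof
  assume "agree k (shift (k, i) e T) (shift (k, j) e X)"
  then have "shift (k, j) e X (k, j) = shift (k, i) e T (k, j)" by (simp add: agree_def)
  with assms show "i = j" by (auto simp: shift_def agree_def split: if_splits)
qed (use assms in \<open>auto simp: shift_def agree_def\<close>)

lemma restrict_to_tab_term:
  "restrict_to P (tab_term B c X) = (if P X then tab_term B c X else 0)"
  by (rule poly_mapping_eqI) (auto simp: tab_term_def lookup_basis_vec)

text \<open>On vectors whose tableaux share the rows up to \<open>k\<close>, projecting to prescribed rows up to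
  \<open>k\<close> isolates the \<open>i\<close>-th term of the formulas for \<open>E\<^sub>k\<^sub>,\<^sub>k\<^sub>+\<^sub>1\<close> and \<open>E\<^sub>k\<^sub>+\<^sub>1\<^sub>,\<^sub>k\<close>.\<close>

lemma restrict_to_gt_step:
  assumes v: "\<And>X. X \<in> supp v \<Longrightarrow> agree k T X" and e: "e \<noteq> 0" and i: "i \<in> {1..k}"
  shows "restrict_to (agree k (shift (k, i) e T)) (gt_step B e k v) =
    lin_ext (\<lambda>X. tab_term B (step_coeff e k i X) (shift (k, i) e X)) v"
proof -
  let ?r = "restrict_to (agree k (shift (k, i) e T))"
  interpret r: Vector_Spaces.linear cscale cscale ?r by (rule linear_diag_op)
  have "?r (gt_step B e k v) =
      lin_ext (\<lambda>X. \<Sum>j = 1..k. ?r (tab_term B (step_coeff e k j X) (shift (k, j) e X))) v"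
    unfolding gt_step_def by (subst linear_lin_ext_comp[OF linear_diag_op]) (simp add: r.sum)
  also have "\<dots> = lin_ext (\<lambda>X. tab_term B (step_coeff e k i X) (shift (k, i) e X)) v"
  proof (rule lin_ext_cong)
    fix X assume "X \<in> supp v"
    then have "agree k T X" by (rule v)
    then have "?r (tab_term B (step_coeff e k j X) (shift (k, j) e X)) =
        (if i = j then tab_term B (step_coeff e k i X) (shift (k, i) e X) else 0)" for j
      using agree_shift[OF _ e, of k T X i j] by (auto simp: restrict_to_tab_term)
    then show "(\<Sum>j = 1..k. ?r (tab_term B (step_coeff e k j X) (shift (k, j) e X))) =
        tab_term B (step_coeff e k i X) (shift (k, i) e X)"
      using i by simp
  qed
  finally show ?thesis .
qed

section \<open>Realizations of a relation graph\<close>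

lemma of_int_in_Nats_iff: "(of_int m :: complex) \<in> \<nat> \<longleftrightarrow> 0 \<le> m"
  by (auto simp: Nats_altdef1)

lemma of_int_in_Nats_diff_iff: "(of_int m :: complex) \<in> \<nat> - {0} \<longleftrightarrow> 0 < m"
  by (auto simp: of_int_in_Nats_iff)

lemma pos_Nats_cases:
  assumes "x \<in> \<nat> - {0 :: 'a :: semiring_char_0}"
  obtains m where "x = of_nat m" "m \<noteq> 0"
  using assms by (auto elim!: Nats_cases)

lemma pos_Nats_iff: "(x :: complex) \<in> \<nat> - {0} \<longleftrightarrow> x - 1 \<in> \<nat>"
proof
  assume "x \<in> \<nat> - {0}"
  then obtain m where "x = of_nat m" "m \<noteq> 0" by (rule pos_Nats_cases)
  then show "x - 1 \<in> \<nat>" by (cases m) auto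
next
  assume "x - 1 \<in> \<nat>"
  then obtain m where "x - 1 = of_nat m" by (auto elim!: Nats_cases)
  then have "x = of_nat (Suc m)" by (simp add: algebra_simps)
  then show "x \<in> \<nat> - {0}" by (simp del: of_nat_Suc)
qed

lemma finite_verts: "finite (verts n)"
  by (rule finite_subset[of _ "{1..n} \<times> {1..n}"]) (auto simp: verts_def)

text \<open>The basis tableaux are realizations in their own right; \<open>L\<close> enters only through the coset of
  integer shifts in which they lie.\<close>

locale relation_module =
  fixes n :: nat and G :: digraph and L :: tableau
  assumes relation_graph: "relation_graph n G"
begin

abbreviation B :: "tableau set" where "B \<equiv> real_basis n G L"

lemma G_verts: "((a, b), (c, d)) \<in> G \<Longrightarrow>
    1 \<le> b \<and> b \<le> a \<and> a \<le> n \<and> 1 \<le> d \<and> d \<le> c \<and> c \<le> n"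
  using relation_graph by (auto simp: relation_graph_def verts_def)

lemma G_rows: "((a, b), (c, d)) \<in> G \<Longrightarrow> a = c + 1 \<or> c = a + 1 \<or> a = n \<and> c = n"
  using relation_graph[unfolded relation_graph_def, THEN conjunct2, THEN conjunct1] by blast

lemma no_backward_path: "\<lbrakk>1 \<le> i; i < j; j \<le> k; k \<le> n\<rbrakk> \<Longrightarrow> ((k, j), (k, i)) \<notin> G\<^sup>+"
  using relation_graph by (simp add: relation_graph_def)

lemma G_irrefl: "(u, u) \<notin> G"
  using relation_graph[unfolded relation_graph_def, THEN conjunct2, THEN conjunct2,
      THEN conjunct2, THEN conjunct1] unfolding acyclic_def by blast

lemma path_of_component:
  assumes "1 \<le> i" "i < j" "j \<le> k" "k < n"
    and "same_component G (k, i) (k, j)"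
  shows "((k, i), (k, j)) \<in> G\<^sup>+"
proof -
  have "((k, i), (k, j)) \<in> G\<^sup>* \<or> ((k, j), (k, i)) \<in> G\<^sup>*"
    using relation_graph[unfolded relation_graph_def, THEN conjunct2, THEN conjunct2,
        THEN conjunct2, THEN conjunct2, THEN conjunct1] assms by simp
  then show ?thesis
    using no_backward_path[of i j k] assms by (auto simp: rtrancl_eq_or_trancl)
qed

lemma same_component_sym: "same_component G u v \<Longrightarrow> same_component G v u"
  unfolding same_component_def by (metis converse_Un converse_converse rtrancl_converseD sup_commute)

lemma same_component_trans:
  "same_component G u v \<Longrightarrow> same_component G v w \<Longrightarrow> same_component G u w"
  unfolding same_component_def by (rule rtrancl_trans)

lemma path_imp_same_component: "(u, v) \<in> G\<^sup>+ \<Longrightarrow> same_component G u v"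
  unfolding same_component_def
  by (metis (no_types, lifting) Un_upper1 rtrancl_mono subsetD trancl_into_rtrancl)

lemma B_realization: "X \<in> B \<Longrightarrow> realization n G X"
  by (simp add: real_basis_def)

lemma B_down:
  assumes "X \<in> B" "((r + 1, a), (r, b)) \<in> G"
  shows "X (r + 1, a) - X (r, b) \<in> \<nat>"
  using assms by (auto simp: real_basis_def realization_def satisfies_def)

lemma B_up:
  assumes "X \<in> B" "((r, a), (r + 1, b)) \<in> G"
  shows "X (r, a) - X (r + 1, b) \<in> \<nat> - {0}"
  using assms unfolding real_basis_def realization_def satisfies_def by blast

lemma B_eq_off: "X \<in> B \<Longrightarrow> S \<in> B \<Longrightarrow> v \<notin> verts n \<Longrightarrow> X v = S v"
  unfolding real_basis_def realization_def tableaux_def by (simp del: split_paired_All)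

lemma B_eq_top: "X \<in> B \<Longrightarrow> S \<in> B \<Longrightarrow> X (n, i) = S (n, i)"
  by (auto simp: real_basis_def shifts_def)

lemma B_diff:
  assumes "X \<in> B" "S \<in> B"
  obtains z where "\<And>v. S v = X v + of_int (z v)" "\<And>v. v \<notin> verts n \<Longrightarrow> z v = 0"
    "\<And>i. z (n, i) = 0"
proof -
  obtain x s where x: "x \<in> shifts n" "X = (\<lambda>v. L v + of_int (x v))"
    and s: "s \<in> shifts n" "S = (\<lambda>v. L v + of_int (s v))"
    using assms by (auto simp: real_basis_def)
  show ?thesis
    by (rule that[of "\<lambda>v. s v - x v"]) (use x s in \<open>auto simp: shifts_def\<close>)
qed

text \<open>The conclusion for \<open>m = 0\<close> expresses strictness: a path between two different vertices of a row below the top one has to go up at some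
  point, and every arrow pointing up is strict.\<close>

lemma path_decrease:
  assumes X: "X \<in> B" and p: "(u, v) \<in> G\<^sup>+"
  shows "\<exists>m::nat. X u - X v = of_nat m \<and>
    (m = 0 \<longrightarrow> fst v \<le> fst u \<and> (fst v = fst u \<longrightarrow> fst u = n))"
proof -
  have arrow: "\<exists>m::nat. X u - X v = of_nat m \<and>
      (m = 0 \<longrightarrow> fst v + 1 = fst u \<or> fst u = n \<and> fst v = n)" if uv: "(u, v) \<in> G" for u v
  proof -
    obtain a b c d where ab: "u = (a, b)" "v = (c, d)" by (metis surj_pair)
    have sat: "satisfies G X" using X by (simp add: real_basis_def realization_def)
    consider "a = c + 1" | "c = a + 1" | "a = n" "c = n" using G_rows uv ab by blast
    then show ?thesis
    proof cases
      case 1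
      then have "X u - X v \<in> \<nat>" using sat uv ab unfolding satisfies_def by blast
      then show ?thesis using 1 ab by (auto elim!: Nats_cases)
    next
      case 2
      then have "X u - X v \<in> \<nat> - {0}" using sat uv ab unfolding satisfies_def by blast
      then show ?thesis by (auto elim!: Nats_cases)
    next
      case 3
      then have "X u - X v \<in> \<nat>" using sat uv ab unfolding satisfies_def by blast
      then show ?thesis using 3 ab by (auto elim!: Nats_cases)
    qed
  qed
  from p show ?thesis
  proof (induction rule: trancl_induct)
    case (base v)
    then show ?case using arrow[OF base] by force
  next
    case (step v w)
    obtain m where m: "X u - X v = of_nat m"
      "m = 0 \<longrightarrow> fst v \<le> fst u \<and> (fst v = fst u \<longrightarrow> fst u = n)" using step.IH by blast
    obtain m' where m': "X v - X w = of_nat m'"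
      "m' = 0 \<longrightarrow> fst w + 1 = fst v \<or> fst v = n \<and> fst w = n" using arrow[OF step.hyps(2)] by blast
    have "X u - X w = of_nat (m + m')" using m(1) m'(1) by (simp add: algebra_simps)
    then show ?case using m(2) m'(2) by (intro exI[of _ "m + m'"]) auto
  qed
qed

lemma path_decrease_strict:
  assumes "X \<in> B" "((k, i), (k, j)) \<in> G\<^sup>+" "k < n"
  shows "X (k, i) - X (k, j) \<in> \<nat> - {0}"
  using path_decrease[OF assms(1,2)] assms(3) by auto

lemma component_of_integral_diff:
  assumes "X \<in> B" "i \<in> {1..k}" "j \<in> {1..k}" "k < n" "X (k, i) - X (k, j) \<in> \<int>"
  shows "same_component G (k, i) (k, j)"
  using assms unfolding real_basis_def realization_def by force

lemma row_decreasing: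
  assumes "X \<in> B" "1 \<le> i" "i < j" "j \<le> k" "k < n" "X (k, i) - X (k, j) \<in> \<int>"
  shows "X (k, i) - X (k, j) \<in> \<nat> - {0}"
  by (intro path_decrease_strict path_of_component component_of_integral_diff) (use assms in auto)

lemma row_inj:
  assumes "X \<in> B" "i \<in> {1..k}" "j \<in> {1..k}" "k < n" "X (k, i) = X (k, j)"
  shows "i = j"
proof (rule ccontr)
  assume "i \<noteq> j"
  then consider "i < j" | "j < i" by linarith
  then show False
  proof cases
    case 1
    then show ?thesis using row_decreasing[of X i j k] assms by auto
  next
    case 2
    then show ?thesis using row_decreasing[of X j i k] assms by auto
  qed
qed

text \<open>This is what the condition on adjoining pairs says about two entries of row \<open>k\<close> that differ by
  one.  Its first alternative gives the squeezed entries.  In the second one, row \<open>k + 1\<close> has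
  connected entries \<open>s < t\<close> with \<open>X (k, j) > X (k + 1, s)\<close> and \<open>X (k + 1, t) \<ge> X (k, i)\<close>; as
  \<open>k + 1 < n\<close>, that row strictly decreases from \<open>s\<close> to \<open>t\<close>, which puts \<open>X (k + 1, s)\<close> strictly
  between two consecutive values.\<close>

lemma squeezed_entries:
  assumes X: "X \<in> B" and ij: "i \<in> {1..k}" "j \<in> {1..k}" and k: "k + 1 < n"
    and adj: "X (k, j) = X (k, i) + 1"
  obtains p q where "p \<in> {1..k + 1}" "X (k + 1, p) = X (k, i)"
    "q \<in> {1..k - 1}" "X (k - 1, q) = X (k, i) + 1"
proof -
  have "j < i"
  proof (rule ccontr)
    assume "\<not> j < i"
    then have "i < j" using adj by (cases "i = j") auto
    then have "X (k, i) - X (k, j) \<in> \<nat> - {0}" using X ij k adj by (intro row_decreasing) auto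
    moreover have "X (k, i) - X (k, j) = of_int (- 1)" using adj by simp
    ultimately show False by (metis of_int_in_Nats_diff_iff neg_0_less_iff_less not_one_less_zero)
  qed
  have comp: "same_component G (k, j) (k, i)"
    using X ij k adj by (intro component_of_integral_diff) auto
  then have path: "((k, j), (k, i)) \<in> G\<^sup>+" using \<open>j < i\<close> ij k by (intro path_of_component) auto
  have no_between: False
    if y: "X (k, j) - y \<in> \<nat> - {0}" "y - X (k, i) \<in> \<nat> - {0}" for y
  proof -
    obtain a where a: "X (k, j) - y = of_nat a" "a \<noteq> 0" using y(1) by (rule pos_Nats_cases)
    obtain b where b: "y - X (k, i) = of_nat b" "b \<noteq> 0" using y(2) by (rule pos_Nats_cases)
    have "of_nat (a + b) = X (k, j) - X (k, i)" unfolding of_nat_add a(1)[symmetric] b(1)[symmetric] by simp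
    then have "of_nat (a + b) = (of_nat 1 :: complex)" using adj by simp
    then have "a + b = 1" by (rule of_nat_eq_iff[THEN iffD1])
    then show False using a b by simp
  qed
  have "adjoining_pair n G k j i"
  proof -
    have "((k, j), (k, t)) \<notin> G\<^sup>+ \<and> ((k, t), (k, i)) \<notin> G\<^sup>+" if t: "j < t" "t < i" for t
    proof (rule ccontr)
      assume "\<not> ?thesis"
      then have "same_component G (k, j) (k, t) \<and> same_component G (k, t) (k, i)"
        using comp by (meson path_imp_same_component same_component_sym same_component_trans)
      then have "((k, j), (k, t)) \<in> G\<^sup>+" "((k, t), (k, i)) \<in> G\<^sup>+"
        using t ij k by (auto intro!: path_of_component)
      then show False using no_between X k by (meson path_decrease_strict add_lessD1)
    qed
    then show ?thesis using path \<open>j < i\<close> ij k by (auto simp: adjoining_pair_def)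
  qed
  then consider
    p q where "((k, j), (k + 1, p)) \<in> G" "((k + 1, p), (k, i)) \<in> G"
      "((k, j), (k - 1, q)) \<in> G" "((k - 1, q), (k, i)) \<in> G"
    | s t where "s < t" "((k, j), (k + 1, s)) \<in> G" "((k + 1, t), (k, i)) \<in> G"
    using relation_graph[unfolded relation_graph_def, THEN conjunct2, THEN conjunct2,
        THEN conjunct2, THEN conjunct2, THEN conjunct2, THEN conjunct2] by (metis insert_subset)
  then show ?thesis
  proof cases
    case (1 p q)
    have q: "1 \<le> q" "q \<le> k - 1" "1 \<le> k - 1" and p: "1 \<le> p" "p \<le> k + 1"
      using G_verts[OF 1(3)] G_verts[OF 1(1)] by auto
    have "X (k, j) - X (k + 1, p) \<in> \<nat> - {0}" using B_up[OF X 1(1)] .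
    then have "X (k + 1, p) = X (k, i)"
      using no_between[of "X (k + 1, p)"] B_down[OF X 1(2)] by auto
    moreover have "X (k, j) - X (k - 1, q) \<in> \<nat>"
      using B_down[OF X, of "k - 1" j q] 1(3) q by simp
    moreover have "X (k - 1, q) - X (k, i) \<in> \<nat> - {0}" using B_up[OF X, of "k - 1" q i] 1(4) q by simp
    ultimately have "X (k, j) - X (k - 1, q) = 0" using no_between[of "X (k - 1, q)"] by blast
    then have "X (k - 1, q) = X (k, i) + 1" using adj by simp
    then show ?thesis using \<open>X (k + 1, p) = X (k, i)\<close> that p q by simp
  next
    case (2 s t)
    have s: "1 \<le> s" "t \<le> k + 1" using G_verts[OF 2(2)] G_verts[OF 2(3)] by auto
    have "same_component G (k + 1, s) (k, j)" "same_component G (k, i) (k + 1, t)"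
      using 2 by (meson path_imp_same_component same_component_sym r_into_trancl)+
    then have "same_component G (k + 1, s) (k + 1, t)"
      using comp by (meson same_component_trans)
    then have "((k + 1, s), (k + 1, t)) \<in> G\<^sup>+" using 2(1) s k by (intro path_of_component) auto
    then have st: "X (k + 1, s) - X (k + 1, t) \<in> \<nat> - {0}" using X k by (intro path_decrease_strict)
    obtain m where "X (k + 1, t) - X (k, i) = of_nat m"
      using B_down[OF X 2(3)] by (auto elim!: Nats_cases)
    moreover obtain m' where "X (k + 1, s) - X (k + 1, t) = of_nat m'" "m' \<noteq> 0"
      using st by (rule pos_Nats_cases)
    ultimately have "X (k + 1, s) - X (k, i) = of_nat (m + m')" "m + m' \<noteq> 0"
      by (simp_all add: algebra_simps)
    then have "X (k + 1, s) - X (k, i) \<in> \<nat> - {0}" by (metis Diff_iff of_nat_in_Nats of_nat_eq_0_iff singletonD)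
    then show ?thesis using no_between B_up[OF X 2(2)] by blast
  qed
qed

lemma shift_in_B:
  assumes X: "X \<in> B" and k: "i \<in> {1..k}" "k < n" and sat: "satisfies G (shift (k, i) e X)"
  shows "shift (k, i) e X \<in> B"
proof -
  obtain x where x: "x \<in> shifts n" "X = (\<lambda>v. L v + of_int (x v))"
    using X by (auto simp: real_basis_def)
  have "shift (k, i) e X = (\<lambda>v. L v + of_int ((x((k, i) := x (k, i) + e)) v))"
    by (auto simp: shift_def x(2))
  moreover have "x((k, i) := x (k, i) + e) \<in> shifts n"
    using x(1) k by (auto simp: shifts_def verts_def)
  moreover have "realization n G (shift (k, i) e X)"
  proof -
    have diff: "X u - X v \<in> \<int>" if "shift (k, i) e X u - shift (k, i) e X v \<in> \<int>" for u v
    proof -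
      define d :: int where
        "d = (if u = (k, i) then e else 0) - (if v = (k, i) then e else 0)"
      have "X u - X v = (shift (k, i) e X u - shift (k, i) e X v) - of_int d"
        by (simp add: shift_def d_def)
      then show ?thesis using that by simp
    qed
    have "shift (k, i) e X \<in> tableaux n"
      using X k by (auto simp: real_basis_def realization_def tableaux_def shift_def verts_def)
    then show ?thesis using sat B_realization[OF X] diff unfolding realization_def by blast
  qed
  ultimately show ?thesis unfolding real_basis_def by blast
qed

text \<open>Subtracting the least admissible difference along an arrow turns the weak and the strict
  conditions into one.\<close>

definition arrow_gap :: "vertex \<Rightarrow> vertex \<Rightarrow> complex"
  where "arrow_gap u v = of_bool (fst v = fst u + 1)"

lemma satisfies_iff_gap:
  "satisfies G X \<longleftrightarrow> (\<forall>u v. (u, v) \<in> G \<longrightarrow> X u - X v - arrow_gap u v \<in> \<nat>)"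
proof -
  have "(i = r \<or> i = r + 1 \<longrightarrow> X (i, j) - X (r, s) \<in> \<nat>) \<and>
      (r = i + 1 \<longrightarrow> X (i, j) - X (r, s) \<in> \<nat> - {0}) \<longleftrightarrow>
      X (i, j) - X (r, s) - arrow_gap (i, j) (r, s) \<in> \<nat>" if "((i, j), (r, s)) \<in> G" for i j r s
    unfolding pos_Nats_iff using G_rows[OF that] by (auto simp: arrow_gap_def)
  then show ?thesis unfolding satisfies_def split_paired_All by blast
qed

text \<open>Moving an entry by one unit can only break arrows into it (when raising) or out of it (when
  lowering), and it breaks those whose difference is already the least admissible one.\<close>

lemma shift_in_B_of_slack:
  assumes X: "X \<in> B" and k: "i \<in> {1..k}" "k < n" and e: "e \<in> {1, -1}"
    and slack_in: "\<And>u. e = 1 \<Longrightarrow> (u, (k, i)) \<in> G \<Longrightarrow> X u - X (k, i) \<noteq> arrow_gap u (k, i)"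
    and slack_out: "\<And>u. e = -1 \<Longrightarrow> ((k, i), u) \<in> G \<Longrightarrow> X (k, i) - X u \<noteq> arrow_gap (k, i) u"
  shows "shift (k, i) e X \<in> B"
proof (rule shift_in_B[OF X k], unfold satisfies_iff_gap, intro allI impI)
  let ?Y = "shift (k, i) e X"
  fix u v assume uv: "(u, v) \<in> G"
  let ?x = "X u - X v - arrow_gap u v"
  have x: "?x \<in> \<nat>"
    using B_realization[OF X] uv unfolding realization_def satisfies_iff_gap by blast
  have pred: "?x - 1 \<in> \<nat>" if "?x \<noteq> 0" using x that pos_Nats_iff by blast
  have "u \<noteq> v" using uv G_irrefl by blast
  then consider "v = (k, i)" "u \<noteq> (k, i)" | "u = (k, i)" "v \<noteq> (k, i)" | "u \<noteq> (k, i)" "v \<noteq> (k, i)"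
    by blast
  then show "?Y u - ?Y v - arrow_gap u v \<in> \<nat>"
  proof cases
    case 1
    then have "?Y u - ?Y v - arrow_gap u v = ?x - of_int e" by (simp add: shift_def)
    moreover have "?x - of_int e \<in> \<nat>"
    proof (cases "e = 1")
      case True
      then show ?thesis using pred slack_in[of u] uv 1 by simp
    next
      case False
      then show ?thesis using Nats_add[OF x Nats_1] e by simp
    qed
    ultimately show ?thesis by (simp only:)
  next
    case 2
    then have "?Y u - ?Y v - arrow_gap u v = ?x + of_int e" by (simp add: shift_def)
    moreover have "?x + of_int e \<in> \<nat>"
    proof (cases "e = 1")
      case True
      then show ?thesis using Nats_add[OF x Nats_1] by simp
    next
      case False
      then show ?thesis using pred slack_out[of v] uv 2 e by simp
    qed
    ultimately show ?thesis by (simp only:)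
  next
    case 3
    then show ?thesis using x by (simp add: shift_def)
  qed
qed

lemma raise_in_B:
  assumes X: "X \<in> B" and k: "i \<in> {1..k}" "k < n"
    and up: "\<And>j. ((k + 1, j), (k, i)) \<in> G \<Longrightarrow> X (k + 1, j) \<noteq> X (k, i)"
    and down: "\<And>j. ((k - 1, j), (k, i)) \<in> G \<Longrightarrow> X (k - 1, j) \<noteq> X (k, i) + 1"
  shows "shift (k, i) 1 X \<in> B"
proof (rule shift_in_B_of_slack[OF X k])
  fix u assume g: "(u, (k, i)) \<in> G"
  obtain a b where u: "u = (a, b)" by fastforce
  have "a = k + 1 \<or> k = a + 1" using G_rows[of a b k i] g u k by auto
  then show "X u - X (k, i) \<noteq> arrow_gap u (k, i)"
    using up[of b] down[of b] g u by (auto simp: arrow_gap_def algebra_simps)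
qed auto

lemma lower_in_B:
  assumes X: "X \<in> B" and k: "i \<in> {1..k}" "k < n"
    and up: "\<And>j. ((k, i), (k + 1, j)) \<in> G \<Longrightarrow> X (k + 1, j) \<noteq> X (k, i) - 1"
    and down: "\<And>j. ((k, i), (k - 1, j)) \<in> G \<Longrightarrow> X (k - 1, j) \<noteq> X (k, i)"
  shows "shift (k, i) (- 1) X \<in> B"
proof (rule shift_in_B_of_slack[OF X k])
  fix u assume g: "((k, i), u) \<in> G"
  obtain a b where u: "u = (a, b)" by fastforce
  have "a = k + 1 \<or> k = a + 1" using G_rows[of k i a b] g u k by auto
  then show "X (k, i) - X u \<noteq> arrow_gap (k, i) u"
    using up[of b] down[of b] g u by (auto simp: arrow_gap_def algebra_simps)
qed auto

section \<open>Splitting stable subspaces row by row\<close>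

text \<open>The factor by which \<open>X\<close> is multiplied when its entry at \<open>(k, i)\<close> is moved by \<open>e\<close> and then
  moved back.\<close>

definition loop :: "int \<Rightarrow> nat \<Rightarrow> nat \<Rightarrow> tableau \<Rightarrow> complex"
  where "loop e k i X =
    (if shift (k, i) e X \<in> B
     then step_coeff e k i X * step_coeff (- e) k i (shift (k, i) e X) else 0)"

definition row_poly :: "nat \<Rightarrow> tableau \<Rightarrow> complex poly"
  where "row_poly k X = (\<Prod>j = 1..k. [:- X (k, j), 1:])"

lemma poly_row_poly: "poly (row_poly k X) u = (\<Prod>j = 1..k. u - X (k, j))"
  by (simp add: row_poly_def poly_prod)

lemma poly_row_poly_eq_0_iff: "poly (row_poly k X) u = 0 \<longleftrightarrow> (\<exists>j\<in>{1..k}. u = X (k, j))"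
  by (auto simp: poly_row_poly)

text \<open>The loop through \<open>X + \<delta>\<^sup>k\<^sup>i\<close> evaluates the polynomials of the neighbouring rows at \<open>X (k, i)\<close>, the
  one through \<open>X - \<delta>\<^sup>k\<^sup>i\<close> at \<open>X (k, i) - 1\<close>.\<close>

definition loop_point :: "int \<Rightarrow> nat \<Rightarrow> nat \<Rightarrow> tableau \<Rightarrow> complex"
  where "loop_point e k i X = X (k, i) - of_bool (e = -1)"

text \<open>The product formula also covers the loops that vanish because the intermediate tableau is
  not in the basis: the broken arrow of \<open>G\<close> then makes one of the two polynomials vanish.  The only
  exception is an intermediate tableau with two equal entries in row \<open>k\<close>, where the denominator
  is zero.\<close>

lemma loop_eq:
  assumes X: "X \<in> B" and k: "i \<in> {1..k}" "k < n" and e: "e \<in> {1, -1}"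
  shows "loop e k i X =
    (if \<exists>j\<in>{1..k}. X (k, j) = X (k, i) + of_int e then 0
     else - (poly (row_poly (k + 1) X) (loop_point e k i X) *
             poly (row_poly (k - 1) X) (loop_point e k i X + 1)) /
       ((\<Prod>j\<in>{1..k} - {i}. X (k, i) - X (k, j)) *
        (\<Prod>j\<in>{1..k} - {i}. X (k, i) + of_int e - X (k, j))))"
proof -
  let ?Y = "shift (k, i) e X" and ?u = "loop_point e k i X"
  have row: "?Y (k, j) = (if j = i then X (k, i) + of_int e else X (k, j))"
    "?Y (k - 1, j) = X (k - 1, j)" "?Y (k + 1, j) = X (k + 1, j)" for j
    using k by (auto simp: shift_def)
  show ?thesis
  proof (cases "\<exists>j\<in>{1..k}. X (k, j) = X (k, i) + of_int e")
    case True
    then obtain j where j: "j \<in> {1..k}" "X (k, j) = X (k, i) + of_int e" by blast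
    then have "i \<noteq> j" using e by auto
    then have "?Y \<notin> B" using row_inj[of ?Y i k j] j k row(1)[of i] row(1)[of j] by auto
    then show ?thesis using True by (simp add: loop_def)
  next
    case nadj: False
    show ?thesis
    proof (cases "?Y \<in> B")
      case True
      have den: "(\<Prod>j\<in>{1..k} - {i}. ?Y (k, i) - ?Y (k, j)) =
          (\<Prod>j\<in>{1..k} - {i}. X (k, i) + of_int e - X (k, j))"
        by (rule prod.cong) (auto simp: row)
      have num: "(\<Prod>j = 1..k + 1. ?Y (k, i) - ?Y (k + 1, j)) =
          (\<Prod>j = 1..k + 1. X (k, i) + of_int e - X (k + 1, j))"
        "(\<Prod>j = 1..k - 1. ?Y (k, i) - ?Y (k - 1, j)) =
          (\<Prod>j = 1..k - 1. X (k, i) + of_int e - X (k - 1, j))"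
        by (simp_all only: row simp_thms if_True)
      show ?thesis
        using nadj True e unfolding loop_def step_coeff_def den num poly_row_poly loop_point_def
        by (auto simp del: prod.cl_ivl_Suc)
    next
      case False
      have "poly (row_poly (k + 1) X) ?u = 0 \<or> poly (row_poly (k - 1) X) (?u + 1) = 0"
      proof (rule ccontr)
        assume nz: "\<not> ?thesis"
        then have up: "X (k + 1, j) \<noteq> ?u" if "j \<in> {1..k + 1}" for j
          using nz that unfolding poly_row_poly_eq_0_iff by metis
        have down: "X (k - 1, j) \<noteq> ?u + 1" if "j \<in> {1..k - 1}" for j
          using nz that unfolding poly_row_poly_eq_0_iff by metis
        have "?Y \<in> B"
        proof (cases "e = 1")
          case True
          then have u: "?u = X (k, i)" by (simp add: loop_point_def)
          show ?thesis unfolding True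
          proof (rule raise_in_B[OF X k])
            show "X (k + 1, j) \<noteq> X (k, i)" if "((k + 1, j), (k, i)) \<in> G" for j
              using up[of j] G_verts[OF that] u by simp
            show "X (k - 1, j) \<noteq> X (k, i) + 1" if "((k - 1, j), (k, i)) \<in> G" for j
              using down[of j] G_verts[OF that] u by simp
          qed
        next
          case ne: False
          then have e': "e = -1" using e by simp
          then have u: "?u = X (k, i) - 1" by (simp add: loop_point_def)
          show ?thesis unfolding e'
          proof (rule lower_in_B[OF X k])
            show "X (k + 1, j) \<noteq> X (k, i) - 1" if "((k, i), (k + 1, j)) \<in> G" for j
              using up[of j] G_verts[OF that] u by simp
            show "X (k - 1, j) \<noteq> X (k, i)" if "((k, i), (k - 1, j)) \<in> G" for j
              using down[of j] G_verts[OF that] u by simp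
          qed
        qed
        then show False using False by simp
      qed
      then show ?thesis using nadj False by (auto simp: loop_def)
    qed
  qed
qed

text \<open>Rows are strictly decreasing within each class modulo the integers, and a basis tableau
  never leaves its classes.  So equality of the sets of entries forces equality of the entries,
  by induction along the row.\<close>

lemma row_determined_by_poly:
  assumes X: "X \<in> B" and S: "S \<in> B" and k: "k < n" and p: "row_poly k X = row_poly k S"
    and j: "j \<in> {1..k}"
  shows "X (k, j) = S (k, j)"
proof -
  have le: "X (k, j) - S (k, j) \<in> \<nat>"
    if XS: "X \<in> B" "S \<in> B" "row_poly k X = row_poly k S"
      and IH: "\<And>m. m \<in> {1..k} \<Longrightarrow> m < j \<Longrightarrow> X (k, m) = S (k, m)" and j: "j \<in> {1..k}" for X S j
  proof -
    have "poly (row_poly k X) (S (k, j)) = 0"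
      using j unfolding XS(3) poly_row_poly_eq_0_iff by auto
    then obtain m where m: "m \<in> {1..k}" "S (k, j) = X (k, m)"
      unfolding poly_row_poly_eq_0_iff by auto
    show ?thesis
    proof (cases "m = j")
      case False
      have "\<not> m < j"
      proof
        assume "m < j"
        then have "S (k, m) = S (k, j)" using IH m by simp
        then show False using row_inj[OF XS(2) m(1) j k] \<open>m < j\<close> by simp
      qed
      then have "j < m" using False by simp
      obtain z where "\<And>v. S v = X v + of_int (z v)" using B_diff XS(1,2) by metis
      then have "X (k, j) - X (k, m) = of_int (- z (k, j))" using m(2) by (metis add_diff_cancel_left' minus_diff_eq of_int_minus)
      then show ?thesis
        using row_decreasing[of X j m k] XS(1) j m \<open>j < m\<close> k by (auto simp: m(2))
    qed (use m in simp)
  qed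
  from j show ?thesis
  proof (induction j rule: less_induct)
    case (less j)
    have IH: "X (k, m) = S (k, m)" if "m \<in> {1..k}" "m < j" for m using less.IH that by blast
    obtain a where a: "X (k, j) - S (k, j) = of_nat a"
      using le[OF X S p IH less.prems] by (auto elim!: Nats_cases)
    obtain b where b: "S (k, j) - X (k, j) = of_nat b"
      using le[OF S X p[symmetric] IH[symmetric] less.prems] by (auto elim!: Nats_cases)
    have "of_nat (a + b) = (0 :: complex)"
      unfolding of_nat_add a[symmetric] b[symmetric] by simp
    then have "a = 0" unfolding of_nat_eq_0_iff by simp
    then show ?case using a by simp
  qed
qed

text \<open>With \<open>m\<close> the size of \<open>A \<inter> (A - 1)\<close>, the union \<open>A \<union> (A - 1)\<close> has \<open>2 |A| - m\<close> points, of which at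
  most \<open>|Q| - m\<close> are removed.\<close>

lemma card_diff_shifted:
  fixes A :: "complex set"
  assumes "finite A" "finite Q" "A \<inter> (\<lambda>x. x - 1) ` A \<subseteq> Q" "card Q < card A"
  shows "card A < card ((A \<union> (\<lambda>x. x - 1) ` A) - (Q - A \<inter> (\<lambda>x. x - 1) ` A))"
proof -
  let ?A' = "(\<lambda>x. x - 1) ` A"
  have "card ?A' = card A" by (intro card_image) (auto simp: inj_on_def)
  then have "card (A \<union> ?A') + card (A \<inter> ?A') = card A + card A"
    using card_Un_Int[of A ?A'] assms(1) by simp
  moreover have "card (Q - A \<inter> ?A') = card Q - card (A \<inter> ?A')"
    using assms by (intro card_Diff_subset finite_Int) auto
  moreover have "card (A \<inter> ?A') \<le> card Q" using assms by (intro card_mono)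
  moreover have "card (A \<union> ?A') - card (Q - A \<inter> ?A') \<le> card ((A \<union> ?A') - (Q - A \<inter> ?A'))"
    using assms by (intro diff_card_le_card_Diff) auto
  ultimately show ?thesis using assms(4) by linarith
qed

text \<open>The points used are the \<open>T (k, i)\<close> and the \<open>T (k, i) - 1\<close>.  At a point of both kinds the
  polynomial of row \<open>k + 1\<close> vanishes by \<open>squeezed_entries\<close>; at any other point its value can be
  read off from a loop unless the polynomial of row \<open>k - 1\<close> vanishes there.  That polynomial has
  only \<open>k - 1\<close> roots, so at least \<open>k + 1\<close> points remain.\<close>

lemma loops_separate:
  assumes T: "T \<in> B" and X: "X \<in> B" and k: "1 \<le> k" "k + 1 < n" and TX: "agree k T X"
    and loops: "\<And>e i. e \<in> {1, -1} \<Longrightarrow> i \<in> {1..k} \<Longrightarrow> loop e k i X = loop e k i T"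
  shows "agree (k + 1) T X"
proof -
  have row: "X (k, j) = T (k, j)" "X (k - 1, j) = T (k - 1, j)" for j
    using TX by (auto simp: agree_def)
  let ?A = "(\<lambda>i. T (k, i)) ` {1..k}" and ?Q = "(\<lambda>q. T (k - 1, q) - 1) ` {1..k - 1}"
  let ?I = "?A \<inter> (\<lambda>x. x - 1) ` ?A"
  let ?U = "(?A \<union> (\<lambda>x. x - 1) ` ?A) - (?Q - ?I)"
  have cardA: "card ?A = k"
    using row_inj[OF T] k by (subst card_image) (auto simp: inj_on_def)
  have squeezed: "poly (row_poly (k + 1) Y) u = 0 \<and> u \<in> ?Q"
    if Y: "Y \<in> {X, T}" and u: "u \<in> ?I" for u Y
  proof -
    have YB: "Y \<in> B" and Yrow: "Y (k, i) = T (k, i)" "Y (k - 1, i) = T (k - 1, i)" for i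
      using Y T X row by auto
    obtain i j where ij: "i \<in> {1..k}" "j \<in> {1..k}" "u = T (k, i)" "u = T (k, j) - 1"
      using u by auto
    then have "Y (k, j) = Y (k, i) + 1" unfolding Yrow using ij(3,4) by (metis diff_add_cancel)
    then obtain p q where "p \<in> {1..k + 1}" "Y (k + 1, p) = Y (k, i)"
      "q \<in> {1..k - 1}" "Y (k - 1, q) = Y (k, i) + 1"
      using squeezed_entries[OF YB ij(1,2) k(2)] by blast
    then show ?thesis
      unfolding poly_row_poly_eq_0_iff Yrow ij(3) by (force simp: image_iff eq_diff_eq)
  qed
  have "card ?A < card ?U"
  proof (rule card_diff_shifted)
    show "?I \<subseteq> ?Q" using squeezed[of T] by blast
    have "card ?Q \<le> k - 1" using card_image_le[of "{1..k - 1}" "\<lambda>q. T (k - 1, q) - 1"] by simp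
    then show "card ?Q < card ?A" using cardA k by simp
  qed auto
  then have "k + 1 \<le> card ?U" using cardA by simp
  have "row_poly (k + 1) X = row_poly (k + 1) T"
  proof (rule poly_eqI_degree_lead_coeff[where n = "k + 1" and A = ?U])
    have deg: "degree (row_poly m Y) = m" "lead_coeff (row_poly m Y) = 1" for m Y
    proof -
      show "degree (row_poly m Y) = m" by (simp add: row_poly_def degree_prod_eq_sum_degree)
      show "lead_coeff (row_poly m Y) = 1" unfolding row_poly_def lead_coeff_prod by simp
    qed
    show "degree (row_poly (k + 1) X) \<le> k + 1" "degree (row_poly (k + 1) T) \<le> k + 1"
      by (simp_all only: deg order_refl)
    show "coeff (row_poly (k + 1) X) (k + 1) = coeff (row_poly (k + 1) T) (k + 1)"
      using deg(2)[of "k + 1" X] deg(2)[of "k + 1" T] unfolding deg(1) by simp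
    show "k + 1 \<le> card ?U" by fact
    fix u assume u: "u \<in> ?U"
    show "poly (row_poly (k + 1) X) u = poly (row_poly (k + 1) T) u"
    proof (cases "u \<in> ?I")
      case True
      then show ?thesis using squeezed by simp
    next
      case False
      then have "u \<notin> ?Q" using u by blast
      obtain e i where ei: "e \<in> {1, -1}" "i \<in> {1..k}" "u = loop_point e k i T"
      proof -
        consider i where "i \<in> {1..k}" "u = T (k, i)" | i where "i \<in> {1..k}" "u = T (k, i) - 1"
          using u by auto
        then show ?thesis
          by cases (use that[of 1] that[of "-1"] in \<open>auto simp: loop_point_def\<close>)
      qed
      have nadj: "\<not> (\<exists>j\<in>{1..k}. T (k, j) = T (k, i) + of_int e)"
      proof
        assume "\<exists>j\<in>{1..k}. T (k, j) = T (k, i) + of_int e"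
        then obtain j where j: "j \<in> {1..k}" "T (k, j) = T (k, i) + of_int e" by blast
        have "u \<in> ?I"
        proof (cases "e = 1")
          case True
          then have "u = T (k, i)" "u = T (k, j) - 1" using ei j by (auto simp: loop_point_def)
          then show ?thesis using ei(2) j(1) by blast
        next
          case ne: False
          then have "u = T (k, j)" "u = T (k, i) - 1" using ei j by (auto simp: loop_point_def)
          then show ?thesis using ei(2) j(1) by blast
        qed
        then show False using False by simp
      qed
      let ?d = "(\<Prod>j\<in>{1..k} - {i}. T (k, i) - T (k, j)) *
        (\<Prod>j\<in>{1..k} - {i}. T (k, i) + of_int e - T (k, j))"
      have "T (k, i) \<noteq> T (k, j)" if "j \<in> {1..k} - {i}" for j
        using row_inj[OF T ei(2)] that k by auto
      then have d: "?d \<noteq> 0" using nadj by auto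
      have kn: "k < n" using k by simp
      have lp: "loop_point e k i X = u" using ei(3) by (simp add: loop_point_def row)
      have low: "poly (row_poly (k - 1) X) (u + 1) = poly (row_poly (k - 1) T) (u + 1)"
        unfolding row_poly_def row ..
      have "poly (row_poly (k - 1) T) (u + 1) \<noteq> 0"
        using \<open>u \<notin> ?Q\<close> unfolding poly_row_poly_eq_0_iff by (auto simp: image_iff eq_diff_eq)
      moreover have "poly (row_poly (k + 1) X) u * poly (row_poly (k - 1) T) (u + 1) =
          poly (row_poly (k + 1) T) u * poly (row_poly (k - 1) T) (u + 1)"
        using loops[OF ei(1,2)] nadj d k
        unfolding loop_eq[OF X ei(2) kn ei(1)] loop_eq[OF T ei(2) kn ei(1)] row lp ei(3)[symmetric] low
        by simp
      ultimately show ?thesis by simp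
    qed
  qed
  then have "X (k + 1, j) = T (k + 1, j)" if "j \<in> {1..k + 1}" for j
    using row_determined_by_poly[OF X T k(2)] that by blast
  then have "X (k + 1, j) = T (k + 1, j)" for j
    using B_eq_off[OF X T] by (cases "j \<in> {1..k + 1}") (auto simp: verts_def)
  then show ?thesis using TX unfolding agree_def by (metis le_Suc_eq Suc_eq_plus1)
qed

text \<open>\<open>W\<close> is the direct sum of its parts with prescribed rows up to \<open>k\<close>.\<close>

definition splits :: "nat \<Rightarrow> (tableau \<Rightarrow>\<^sub>0 complex) set \<Rightarrow> bool"
  where "splits k W \<longleftrightarrow> (\<forall>v\<in>W. \<forall>T. restrict_to (agree k T) v \<in> W)"

lemma splitsI:
  assumes W: "cvec.subspace W" "W \<subseteq> {v. supp v \<subseteq> B}"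
    and "\<And>v T. v \<in> W \<Longrightarrow> T \<in> B \<Longrightarrow> restrict_to (agree k T) v \<in> W"
  shows "splits k W"
  unfolding splits_def
proof (intro ballI allI)
  fix v T assume v: "v \<in> W"
  show "restrict_to (agree k T) v \<in> W"
  proof (cases "\<exists>T'\<in>supp v. agree k T T'")
    case True
    then obtain T' where T': "T' \<in> supp v" "agree k T T'" by blast
    then have "agree k T = agree k T'" by (auto simp: agree_def fun_eq_iff)
    then show ?thesis using assms(3)[OF v, of T'] T' v W(2) by auto
  next
    case False
    then have "supp (restrict_to (agree k T) v) = {}" by (auto simp: supp_restrict_to)
    then show ?thesis using cvec.subspace_0[OF W(1)] by simp
  qed
qed

text \<open>Projecting after each of the two steps isolates the loop at the single entry \<open>(k, i)\<close>.\<close>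

lemma diag_op_loop:
  assumes W: "gl_stable n B W" "splits k W" and v: "v \<in> W" "supp v \<subseteq> B"
    and T: "\<And>X. X \<in> supp v \<Longrightarrow> agree k T X"
    and k: "i \<in> {1..k}" "k < n" and e: "e \<in> {1, -1}"
  shows "diag_op (loop e k i) v \<in> W"
proof -
  have stable: "gt_step B e' k w \<in> W" if "e' \<in> {1, -1}" "w \<in> W" for e' w
    using W(1) that k unfolding gl_stable_iff by (metis atLeastAtMost_iff imageI le_trans subsetD)
  let ?f = "\<lambda>X. tab_term B (step_coeff e k i X) (shift (k, i) e X)"
  let ?g = "\<lambda>Y. tab_term B (step_coeff (- e) k i Y) (shift (k, i) (- e) Y)"
  let ?T = "shift (k, i) e T"
  define u where "u = restrict_to (agree k ?T) (gt_step B e k v)"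
  have u: "u = lin_ext ?f v" unfolding u_def using e k T by (intro restrict_to_gt_step) auto
  have "u \<in> W" using W(2) stable[OF e v(1)] by (simp add: splits_def u_def)
  moreover have "- e \<in> {1, -1}" using e by auto
  ultimately have "restrict_to (agree k T) (gt_step B (- e) k u) \<in> W"
    using W(2) stable by (simp add: splits_def)
  also have "restrict_to (agree k T) (gt_step B (- e) k u) = lin_ext ?g u"
    using restrict_to_gt_step[of u k ?T "- e" i B] e k by (auto simp: u_def supp_restrict_to)
  also have "\<dots> = lin_ext (\<lambda>X. lin_ext ?g (?f X)) v"
    unfolding u by (rule linear_lin_ext_comp[OF linear_lin_ext])
  also have "\<dots> = diag_op (loop e k i) v"
    unfolding diag_op_def
  proof (rule lin_ext_cong)
    fix X assume "X \<in> supp v"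
    then have "X \<in> B" using v by blast
    have "lin_ext ?g (0 :: tableau \<Rightarrow>\<^sub>0 complex) = 0" by (simp add: lin_ext_def)
    then show "lin_ext ?g (?f X) = cscale (loop e k i X) (basis_vec X)"
      using \<open>X \<in> B\<close> by (simp add: tab_term_def loop_def lin_ext_scale)
  qed
  finally show ?thesis .
qed

lemma restrict_to_cong:
  assumes "\<And>X. X \<in> supp v \<Longrightarrow> P X \<longleftrightarrow> Q X"
  shows "restrict_to P v = restrict_to Q v"
  by (rule poly_mapping_eqI) (use assms in \<open>auto simp: in_keys_iff\<close>)

lemma stable_splits:
  assumes W: "gl_stable n B W" "W \<subseteq> {v. supp v \<subseteq> B}" and k: "1 \<le> k" "k < n"
  shows "splits k W"
  using k
proof (induction k rule: nat_induct_at_least)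
  case base
  have sub: "cvec.subspace W" using W(1) by (simp add: gl_stable_def)
  show ?case
  proof (rule splitsI[OF sub W(2)])
    fix v T assume v: "v \<in> W" and T: "T \<in> B"
    have "diag_op (\<lambda>X. X (1, 1)) w \<in> W" if w: "w \<in> W" for w
    proof -
      have "gt_diag B 1 w = diag_op (\<lambda>X. X (1, 1)) w"
        unfolding gt_diag_def diag_op_def
        by (rule lin_ext_cong) (use w W(2) in \<open>auto simp: tab_term_def\<close>)
      moreover have "gt_diag B 1 ` W \<subseteq> W" using W(1) base unfolding gl_stable_iff by auto
      ultimately show ?thesis using w by auto
    qed
    then have "restrict_to (\<lambda>X. \<forall>c\<in>{\<lambda>X. X (1, 1)}. c X = c T) v \<in> W"
      by (intro restrict_to_joint_eigenspace sub v) auto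
    also have "restrict_to (\<lambda>X. \<forall>c\<in>{\<lambda>X. X (1, 1)}. c X = c T) v = restrict_to (agree 1 T) v"
    proof (rule restrict_to_cong)
      fix X assume "X \<in> supp v"
      then have "X \<in> B" using v W(2) by blast
      have "X (r, j) = T (r, j)" if "X (1, 1) = T (1, 1)" "r \<le> 1" for r j
        using that B_eq_off[OF \<open>X \<in> B\<close> T, of "(r, j)"] by (cases "(r, j) = (1, 1)") (auto simp: verts_def)
      then show "(\<forall>c\<in>{\<lambda>X. X (1, 1)}. c X = c T) \<longleftrightarrow> agree 1 T X" by (auto simp: agree_def)
    qed
    finally show "restrict_to (agree 1 T) v \<in> W" .
  qed
next
  case (Suc k)
  have sub: "cvec.subspace W" using W(1) by (simp add: gl_stable_def)
  have spl: "splits k W" using Suc by simp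
  have "splits (k + 1) W"
  proof (rule splitsI[OF sub W(2)])
    fix v T assume v: "v \<in> W" and T: "T \<in> B"
    \<comment> \<open>The loops act diagonally only on vectors whose tableaux share the rows up to \<open>k\<close>.\<close>
    let ?W = "W \<inter> {v. supp v \<subseteq> {X. agree k T X}}"
    let ?C = "{loop e k i | e i. e \<in> {1, -1} \<and> i \<in> {1..k}}"
    have "cvec.subspace ?W" by (intro cvec.subspace_inter sub subspace_supp)
    moreover have "diag_op c w \<in> ?W" if "c \<in> ?C" "w \<in> ?W" for c w
    proof -
      obtain e i where ei: "c = loop e k i" "e \<in> {1, -1}" "i \<in> {1..k}" using \<open>c \<in> ?C\<close> by blast
      have "supp w \<subseteq> B" "\<And>X. X \<in> supp w \<Longrightarrow> agree k T X" "w \<in> W"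
        using that(2) W(2) by auto
      then have "diag_op c w \<in> W"
        unfolding ei(1) using ei(2,3) Suc.prems
        by (intro diag_op_loop[OF W(1) spl, of w T]) auto
      moreover have "supp (diag_op c w) \<subseteq> supp w" by (auto simp: in_keys_iff)
      ultimately show ?thesis using that by auto
    qed
    moreover have "restrict_to (agree k T) v \<in> ?W"
      using spl v by (auto simp: splits_def supp_restrict_to)
    ultimately have "restrict_to (\<lambda>X. \<forall>c\<in>?C. c X = c T) (restrict_to (agree k T) v) \<in> ?W"
      by (intro restrict_to_joint_eigenspace)
    moreover have "restrict_to (\<lambda>X. \<forall>c\<in>?C. c X = c T) (restrict_to (agree k T) v) =
        restrict_to (\<lambda>X. agree k T X \<and> (\<forall>c\<in>?C. c X = c T)) v"
      by (rule poly_mapping_eqI) (simp only: lookup_diag_op of_bool_conj ac_simps)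
    moreover have "\<dots> = restrict_to (agree (k + 1) T) v"
    proof (rule restrict_to_cong)
      fix X assume "X \<in> supp v"
      then have X: "X \<in> B" using v W(2) by blast
      show "agree k T X \<and> (\<forall>c\<in>?C. c X = c T) \<longleftrightarrow> agree (k + 1) T X"
      proof
        assume A: "agree k T X \<and> (\<forall>c\<in>?C. c X = c T)"
        show "agree (k + 1) T X"
        proof (rule loops_separate[OF T X])
          show "1 \<le> k" "k + 1 < n" using Suc.hyps Suc.prems by auto
          show "agree k T X" using A by blast
          show "loop e k i X = loop e k i T" if "e \<in> {1, -1}" "i \<in> {1..k}" for e i
            using A that by blast
        qed
      next
        assume A: "agree (k + 1) T X"
        then have rows: "X (k, j) = T (k, j)" "X (k - 1, j) = T (k - 1, j)"
          "X (k + 1, j) = T (k + 1, j)" for j by (auto simp: agree_def)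
        have "loop e k i X = loop e k i T" if "e \<in> {1, -1}" "i \<in> {1..k}" for e i
        proof -
          have k: "k < n" using Suc.prems by simp
          show ?thesis
            unfolding loop_eq[OF X that(2) k that(1)] loop_eq[OF T that(2) k that(1)]
              row_poly_def loop_point_def rows ..
        qed
        then show "agree k T X \<and> (\<forall>c\<in>?C. c X = c T)" using A by (auto simp: agree_def)
      qed
    qed
    ultimately show "restrict_to (agree (k + 1) T) v \<in> W" by simp
  qed
  then show ?case by simp
qed

lemma stable_step:
  assumes W: "gl_stable n B W" "W \<subseteq> {v. supp v \<subseteq> B}" and X: "basis_vec X \<in> W"
    and k: "i \<in> {1..k}" "k < n" and e: "e \<in> {1, -1}"
    and Y: "shift (k, i) e X \<in> B" and c: "step_coeff e k i X \<noteq> 0"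
  shows "basis_vec (shift (k, i) e X) \<in> W"
proof -
  have sub: "cvec.subspace W" using W(1) by (simp add: gl_stable_def)
  have "gt_step B e k (basis_vec X) \<in> W"
    using W(1) X k e unfolding gl_stable_iff by (metis atLeastAtMost_iff imageI le_trans subsetD)
  then have "restrict_to (agree k (shift (k, i) e X)) (gt_step B e k (basis_vec X)) \<in> W"
    using stable_splits[OF W, of k] k by (auto simp: splits_def)
  also have "restrict_to (agree k (shift (k, i) e X)) (gt_step B e k (basis_vec X)) =
      lin_ext (\<lambda>X. tab_term B (step_coeff e k i X) (shift (k, i) e X)) (basis_vec X)"
    using e k by (intro restrict_to_gt_step) (auto simp: agree_def)
  also have "\<dots> = cscale (step_coeff e k i X) (basis_vec (shift (k, i) e X))"
    using Y by (simp add: tab_term_def)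
  finally have "cscale (1 / step_coeff e k i X)
      (cscale (step_coeff e k i X) (basis_vec (shift (k, i) e X))) \<in> W"
    by (rule cvec.subspace_scale[OF sub])
  then show ?thesis using c by simp
qed

section \<open>Arrows pointing down\<close>

abbreviation down :: "tableau \<Rightarrow> digraph" where "down X \<equiv> down_arrows (tab_graph n X)"

lemma down_iff:
  "((a, b), (c, d)) \<in> down X \<longleftrightarrow>
    a = c + 1 \<and> (a, b) \<in> verts n \<and> (c, d) \<in> verts n \<and> X (a, b) - X (c, d) \<in> \<nat>"
  by (auto simp: down_arrows_def tab_graph_def)

text \<open>An arrow can only be lost if its difference is zero, and this difference is then a factor
  in the numerator of the coefficient.\<close>

lemma down_subset_shift:
  assumes c: "step_coeff e k i X \<noteq> 0" and k: "i \<in> {1..k}" and e: "e \<in> {1, -1}"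
  shows "down X \<subseteq> down (shift (k, i) e X)"
proof clarify
  fix a b c d assume A: "((a, b), (c, d)) \<in> down X"
  let ?Y = "shift (k, i) e X" and ?x = "X (a, b) - X (c, d)"
  have ac: "a = c + 1" and x: "?x \<in> \<nat>" and V: "(a, b) \<in> verts n" "(c, d) \<in> verts n"
    using A by (auto simp: down_iff)
  have pred: "?x - 1 \<in> \<nat>" if "?x \<noteq> 0" using x that pos_Nats_iff by blast
  have succ: "?x + 1 \<in> \<nat>" by (rule Nats_add[OF x Nats_1])
  have "?Y (a, b) - ?Y (c, d) \<in> \<nat>"
  proof -
    consider "(a, b) = (k, i)" "e = 1" | "(a, b) = (k, i)" "e = -1"
      | "(c, d) = (k, i)" "e = 1" | "(c, d) = (k, i)" "e = -1"
      | "(a, b) \<noteq> (k, i)" "(c, d) \<noteq> (k, i)" using e by blast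
    then show ?thesis
    proof cases
      case 1
      then have "?Y (a, b) - ?Y (c, d) = ?x + 1" using ac by (auto simp: shift_def)
      then show ?thesis using succ by (simp only:)
    next
      case 2
      then have "?Y (a, b) - ?Y (c, d) = ?x - 1" using ac by (auto simp: shift_def)
      moreover have "?x \<noteq> 0"
      proof
        assume "?x = 0"
        then have "X (k, i) = X (k - 1, d)" "d \<in> {1..k - 1}"
          using 2 ac V by (auto simp: verts_def)
        then show False using assms(1) 2 by (auto simp: step_coeff_def)
      qed
      ultimately show ?thesis using pred by metis
    next
      case 3
      then have "?Y (a, b) - ?Y (c, d) = ?x - 1" using ac by (auto simp: shift_def)
      moreover have "?x \<noteq> 0"
      proof
        assume "?x = 0"
        then have "X (k, i) = X (k + 1, b)" "b \<in> {1..k + 1}"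
          using 3 ac V by (auto simp: verts_def)
        then show False using assms(1) 3 by (auto simp: step_coeff_def simp del: prod.cl_ivl_Suc)
      qed
      ultimately show ?thesis using pred by metis
    next
      case 4
      then have "?Y (a, b) - ?Y (c, d) = ?x + 1" using ac by (auto simp: shift_def)
      then show ?thesis using succ by (simp only:)
    next
      case 5
      have "?Y u = X u" if "u \<noteq> (k, i)" for u using that by (simp add: shift_def)
      from this[OF 5(1)] this[OF 5(2)] show ?thesis using x by (simp only:)
    qed
  qed
  then show "((a, b), (c, d)) \<in> down ?Y" using ac V by (simp add: down_iff)
qed

lemma gl_stable_gen_tableaux:
  "gl_stable n B {v. supp v \<subseteq> gen_tableaux n G L R}" (is "gl_stable n B {v. supp v \<subseteq> ?N}")
  unfolding gl_stable_iff
proof (intro conjI ballI allI impI subspace_supp image_subsetI)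
  let ?V = "{v. supp v \<subseteq> ?N}"
  have tab: "tab_term B c X \<in> ?V" if "X \<in> ?N \<or> c = 0" for c X
    using that by (auto simp: tab_term_def in_keys_iff lookup_basis_vec)
  fix k v assume v: "v \<in> ?V"
  {
    fix e :: int assume e: "e \<in> {1, -1}"
    show "gt_step B e k v \<in> ?V"
      unfolding gt_step_def
    proof (intro lin_ext_in_subspace cvec.subspace_sum subspace_supp)
      fix X i assume X: "X \<in> supp v" and i: "i \<in> {1..k}"
      show "tab_term B (step_coeff e k i X) (shift (k, i) e X) \<in> ?V"
      proof (cases "step_coeff e k i X \<noteq> 0 \<and> shift (k, i) e X \<in> B")
        case True
        then have "shift (k, i) e X \<in> ?N"
          using down_subset_shift[OF _ i e, of X] X v by (auto simp: gen_tableaux_def)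
        then show ?thesis using tab by blast
      next
        case False
        then show ?thesis using tab[of "shift (k, i) e X" 0] by (auto simp: tab_term_def)
      qed
    qed
  }
  show "gt_diag B k v \<in> ?V"
    unfolding gt_diag_def using v tab by (intro lin_ext_in_subspace subspace_supp) blast
qed

text \<open>Let \<open>z = S - X\<close>.  Suppose that the entry \<open>v\<close> has to be raised but that this step is forbidden:
  its coefficient is zero, or it leaves the basis, or it creates a downward arrow that \<open>S\<close> lacks.
  In the first case an entry of the next higher row equals that of \<open>v\<close>; in the others an entry of
  the next lower row equals that of \<open>v\<close> plus one, or the first case recurs.  Comparing with \<open>S\<close>
  shows that this entry, too, has to be raised by at least \<open>z v\<close>.  In both cases \<open>pot\<close> grows by
  one, so an entry of maximal \<open>pot\<close> among those to be raised is free to move.  Lowering is the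
  mirror image.\<close>

lemma step_towards:
  assumes X: "X \<in> B" and S: "S \<in> B" and z: "\<And>v. S v = X v + of_int (z v)"
    and down: "down X \<subseteq> down S" and e: "e \<in> {1, -1}" and pos: "\<exists>v. 0 < e * z v"
  obtains k i where "i \<in> {1..k}" "k < n" "0 < e * z (k, i)" "shift (k, i) e X \<in> B"
    "step_coeff e k i X \<noteq> 0" "down (shift (k, i) e X) \<subseteq> down S"
proof -
  have zV: "v \<in> verts n" "fst v \<noteq> n" if "z v \<noteq> 0" for v
  proof -
    show "v \<in> verts n" using B_eq_off[OF X S, of v] z[of v] that by auto
    show "fst v \<noteq> n" using B_eq_top[OF X S, of "snd v"] z[of v] that by (cases v) auto
  qed
  let ?A = "{v. 0 < e * z v}"
  \<comment> \<open>Doubling the entry makes \<open>pot\<close> grow both towards an equal entry in the next row and towards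
      an entry larger by one in the previous row.\<close>
  define pot where "pot v = of_int e * (2 * Re (X v) + real (fst v))" for v
  have "?A \<subseteq> verts n" using zV by force
  then have "finite ?A" using finite_verts by (rule finite_subset)
  then have "finite (pot ` ?A)" "pot ` ?A \<noteq> {}" using pos by auto
  note fin = this
  obtain v where vA: "Max (pot ` ?A) = pot v" "v \<in> ?A" using Max_in[OF fin] by (rule imageE)
  have v: "pot w \<le> pot v" if "w \<in> ?A" for w
    unfolding vA(1)[symmetric] using fin(1) that by (intro Max_ge imageI)
  obtain k i where ki: "v = (k, i)" by fastforce
  have zpos: "0 < e * z (k, i)" using vA(2) ki by simp
  then have "z (k, i) \<noteq> 0" by auto
  then have k: "i \<in> {1..k}" "k < n" using zV[of "(k, i)"] by (auto simp: verts_def)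
  have no_higher: False if "pot w > pot (k, i)" "e * z (k, i) \<le> e * z w" for w
    using v[of w] that zpos ki by force
  have den: "X (k, i) - X (k, j) \<noteq> 0" if "j \<in> {1..k} - {i}" for j
    using row_inj[OF X k(1)] that k(2) by auto
  have Sdiff: "S u - S w = X u - X w + of_int (z u - z w)" for u w
    by (simp add: z)
  have downS: "S (a, b) - S (c, d) \<in> \<nat>"
    if "a = c + 1" "(a, b) \<in> verts n" "(c, d) \<in> verts n" "X (a, b) - X (c, d) \<in> \<nat>" for a b c d
    using down that by (meson down_iff subsetD)
  have pred: "x - 1 \<in> \<nat>" if "x \<in> \<nat>" "x \<noteq> 0" for x :: complex using that pos_Nats_iff by blast
  let ?Y = "shift (k, i) e X"
  have Yk: "?Y (k, i) = X (k, i) + of_int e" by (simp add: shift_def)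
  have Yo: "?Y u = X u" if "u \<noteq> (k, i)" for u using that by (simp add: shift_def)
  have kV: "(k, i) \<in> verts n" using k by (auto simp: verts_def)
  have "shift (k, i) e X \<in> B \<and> step_coeff e k i X \<noteq> 0 \<and> down ?Y \<subseteq> down S"
  proof (cases "e = 1")
    case e1: True
    have above: "X (k + 1, j) \<noteq> X (k, i)" if "j \<in> {1..k + 1}" for j
    proof
      assume eq: "X (k + 1, j) = X (k, i)"
      have "(k + 1, j) \<in> verts n" using that k by (auto simp: verts_def)
      then have "S (k + 1, j) - S (k, i) \<in> \<nat>" using downS[of "k + 1" k j i] kV eq by simp
      moreover have "S (k + 1, j) - S (k, i) = of_int (z (k + 1, j) - z (k, i))"
        unfolding Sdiff using eq by simp
      ultimately have "z (k, i) \<le> z (k + 1, j)" by (simp add: of_int_in_Nats_iff del: of_int_diff)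
      then show False using no_higher[of "(k + 1, j)"] e1 eq by (simp add: pot_def)
    qed
    have below: False if "1 \<le> k - 1" "X (k - 1, j) = X (k, i) + 1" "z (k, i) \<le> z (k - 1, j)" for j
      using no_higher[of "(k - 1, j)"] that e1 by (simp add: pot_def of_nat_diff)
    have "shift (k, i) 1 X \<in> B"
    proof (rule raise_in_B[OF X k])
      show "X (k + 1, j) \<noteq> X (k, i)" if "((k + 1, j), (k, i)) \<in> G" for j
        using above G_verts[OF that] by simp
      show "X (k - 1, j) \<noteq> X (k, i) + 1" if g: "((k - 1, j), (k, i)) \<in> G" for j
      proof
        assume eq: "X (k - 1, j) = X (k, i) + 1"
        have k1: "1 \<le> k - 1" using G_verts[OF g] by simp
        then have "S (k - 1, j) - S (k, i) \<in> \<nat> - {0}" using B_up[OF S, of "k - 1" j i] g by simp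
        moreover have "S (k - 1, j) - S (k, i) = of_int (1 + z (k - 1, j) - z (k, i))"
          unfolding Sdiff using eq by simp
        ultimately have "z (k, i) \<le> z (k - 1, j)" by (simp only: of_int_in_Nats_diff_iff)
        then show False using below k1 eq by blast
      qed
    qed
    moreover have "step_coeff 1 k i X \<noteq> 0"
      using above den by (auto simp: step_coeff_def simp del: prod.cl_ivl_Suc) metis
    moreover have "down ?Y \<subseteq> down S"
    proof clarify
      fix a b c d assume A: "((a, b), (c, d)) \<in> down ?Y"
      then have ac: "a = c + 1" and V: "(a, b) \<in> verts n" "(c, d) \<in> verts n"
        and y: "?Y (a, b) - ?Y (c, d) \<in> \<nat>" by (auto simp: down_iff)
      have "S (a, b) - S (c, d) \<in> \<nat>"
      proof (cases "X (a, b) - X (c, d) \<in> \<nat>")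
        case True
        then show ?thesis using downS ac V by blast
      next
        case False
        have "(c, d) \<noteq> (k, i)"
        proof
          assume cd: "(c, d) = (k, i)"
          then have "X (a, b) - X (c, d) = (?Y (a, b) - ?Y (c, d)) + 1"
            using ac Yk Yo[of "(a, b)"] e1 by auto
          then show False using False Nats_add[OF y Nats_1] by simp
        qed
        moreover have "(a, b) = (k, i)" using y False calculation by (metis Yo)
        ultimately have y': "?Y (a, b) - ?Y (c, d) = X (k, i) + 1 - X (c, d)"
          using Yk Yo e1 by simp
        \<comment> \<open>The arrow is created by this step, so its difference has just become zero.\<close>
        have eq: "X (c, d) = X (k, i) + 1"
        proof (rule ccontr)
          assume "X (c, d) \<noteq> X (k, i) + 1"
          then have "X (k, i) + 1 - X (c, d) - 1 \<in> \<nat>" using y y' by (intro pred) auto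
          then show False using False \<open>(a, b) = (k, i)\<close> by simp
        qed
        have "c = k - 1" "1 \<le> k - 1" using ac V \<open>(a, b) = (k, i)\<close> by (auto simp: verts_def)
        then have "z (c, d) \<le> z (k, i) - 1" using below[of d] eq by force
        moreover have "S (a, b) - S (c, d) = of_int (z (k, i) - 1 - z (c, d))"
          unfolding Sdiff \<open>(a, b) = (k, i)\<close> by (simp add: eq)
        ultimately show ?thesis by (simp only: of_int_in_Nats_iff)
      qed
      then show "((a, b), (c, d)) \<in> down S" using ac V by (simp add: down_iff)
    qed
    ultimately show ?thesis using e1 by simp
  next
    case False
    then have e1: "e = -1" using e by simp
    have below: "X (k - 1, j) \<noteq> X (k, i)" if "j \<in> {1..k - 1}" for j
    proof
      assume eq: "X (k - 1, j) = X (k, i)"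
      have "(k - 1, j) \<in> verts n" "k = k - 1 + 1" using that k by (auto simp: verts_def)
      then have "S (k, i) - S (k - 1, j) \<in> \<nat>" using downS[of k "k - 1" i j] kV eq by simp
      moreover have "S (k, i) - S (k - 1, j) = of_int (z (k, i) - z (k - 1, j))"
        unfolding Sdiff using eq by simp
      ultimately have "z (k - 1, j) \<le> z (k, i)" by (simp add: of_int_in_Nats_iff del: of_int_diff)
      then show False using no_higher[of "(k - 1, j)"] e1 eq that k by (simp add: pot_def of_nat_diff)
    qed
    have above: False if "X (k + 1, j) = X (k, i) - 1" "z (k + 1, j) \<le> z (k, i)" for j
      using no_higher[of "(k + 1, j)"] that e1 by (simp add: pot_def)
    have "shift (k, i) (- 1) X \<in> B"
    proof (rule lower_in_B[OF X k])
      show "X (k - 1, j) \<noteq> X (k, i)" if "((k, i), (k - 1, j)) \<in> G" for j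
        using below G_verts[OF that] by simp
      show "X (k + 1, j) \<noteq> X (k, i) - 1" if g: "((k, i), (k + 1, j)) \<in> G" for j
      proof
        assume eq: "X (k + 1, j) = X (k, i) - 1"
        have "S (k, i) - S (k + 1, j) \<in> \<nat> - {0}" using B_up[OF S g] .
        moreover have "S (k, i) - S (k + 1, j) = of_int (1 + z (k, i) - z (k + 1, j))"
          unfolding Sdiff using eq by simp
        ultimately have "z (k + 1, j) \<le> z (k, i)" by (simp only: of_int_in_Nats_diff_iff)
        then show False using above eq by blast
      qed
    qed
    moreover have "step_coeff (- 1) k i X \<noteq> 0"
      using below den by (auto simp: step_coeff_def) metis
    moreover have "down ?Y \<subseteq> down S"
    proof clarify
      fix a b c d assume A: "((a, b), (c, d)) \<in> down ?Y"
      then have ac: "a = c + 1" and V: "(a, b) \<in> verts n" "(c, d) \<in> verts n"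
        and y: "?Y (a, b) - ?Y (c, d) \<in> \<nat>" by (auto simp: down_iff)
      have "S (a, b) - S (c, d) \<in> \<nat>"
      proof (cases "X (a, b) - X (c, d) \<in> \<nat>")
        case True
        then show ?thesis using downS ac V by blast
      next
        case False
        have "(a, b) \<noteq> (k, i)"
        proof
          assume ab: "(a, b) = (k, i)"
          then have "X (a, b) - X (c, d) = (?Y (a, b) - ?Y (c, d)) + 1"
            using ac Yk Yo[of "(c, d)"] e1 by auto
          then show False using False Nats_add[OF y Nats_1] by simp
        qed
        moreover have "(c, d) = (k, i)" using y False calculation by (metis Yo)
        ultimately have y': "?Y (a, b) - ?Y (c, d) = X (a, b) - X (k, i) + 1"
          using Yk Yo e1 by simp
        \<comment> \<open>Again the difference of a newly created arrow is zero.\<close>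
        have eq: "X (a, b) = X (k, i) - 1"
        proof (rule ccontr)
          assume "X (a, b) \<noteq> X (k, i) - 1"
          then have "X (a, b) - X (k, i) + 1 - 1 \<in> \<nat>" using y y' by (intro pred) (auto simp: algebra_simps)
          then show False using False \<open>(c, d) = (k, i)\<close> by simp
        qed
        have "a = k + 1" using ac \<open>(c, d) = (k, i)\<close> by simp
        then have "z (k, i) + 1 \<le> z (a, b)" using above[of b] eq by force
        moreover have "S (a, b) - S (c, d) = of_int (z (a, b) - 1 - z (k, i))"
          unfolding Sdiff \<open>(c, d) = (k, i)\<close> by (simp add: eq)
        ultimately show ?thesis by (simp only: of_int_in_Nats_iff)
      qed
      then show "((a, b), (c, d)) \<in> down S" using ac V by (simp add: down_iff)
    qed
    ultimately show ?thesis using e1 by simp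
  qed
  then show ?thesis using that k zpos by blast
qed

lemma stable_contains:
  assumes W: "gl_stable n B W" "W \<subseteq> {v. supp v \<subseteq> B}" and S: "S \<in> B"
    and X: "basis_vec X \<in> W" "down X \<subseteq> down S"
  shows "basis_vec S \<in> W"
proof -
  have XB: "X \<in> B" using X(1) W(2) by auto
  obtain z where "\<And>v. S v = X v + of_int (z v)" by (rule B_diff[OF XB S]) blast
  then show ?thesis
    using X XB
  proof (induction "\<Sum>v\<in>verts n. nat \<bar>z v\<bar>" arbitrary: X z rule: less_induct)
    case less
    show ?case
    proof (cases "\<forall>v. z v = 0")
      case True
      then have "S = X" using less.prems(1) by (auto simp: fun_eq_iff)
      then show ?thesis using less.prems by simp
    next
      case False
      then obtain v where v: "z v \<noteq> 0" by blast
      define e where "e = sgn (z v)"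
      have e: "e \<in> {1, -1}" "\<exists>v. 0 < e * z v"
      proof -
        have "0 < e * z v" using v by (auto simp: e_def sgn_if)
        then show "\<exists>v. 0 < e * z v" ..
      qed (use v in \<open>auto simp: e_def sgn_if\<close>)
      obtain k i where ki: "i \<in> {1..k}" "k < n" "0 < e * z (k, i)" "shift (k, i) e X \<in> B"
        "step_coeff e k i X \<noteq> 0" "down (shift (k, i) e X) \<subseteq> down S"
        using step_towards[OF less.prems(4) S less.prems(1,3) e] by blast
      \<comment> \<open>The number of unit steps from \<open>X\<close> to \<open>S\<close> decreases.\<close>
      let ?z = "z((k, i) := z (k, i) - e)"
      have ez: "\<bar>z (k, i) - e\<bar> < \<bar>z (k, i)\<bar>" using e(1) ki(3) by auto
      have "(\<Sum>v\<in>verts n. nat \<bar>?z v\<bar>) < (\<Sum>v\<in>verts n. nat \<bar>z v\<bar>)"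
      proof (rule sum_strict_mono_ex1[OF finite_verts])
        show "\<forall>v\<in>verts n. nat \<bar>?z v\<bar> \<le> nat \<bar>z v\<bar>" using ez by auto
        show "\<exists>v\<in>verts n. nat \<bar>?z v\<bar> < nat \<bar>z v\<bar>"
          using ez ki by (intro bexI[of _ "(k, i)"]) (auto simp: verts_def)
      qed
      moreover have "S v = shift (k, i) e X v + of_int (?z v)" for v
        using less.prems(1)[of v] by (auto simp: shift_def)
      moreover have "basis_vec (shift (k, i) e X) \<in> W"
        by (rule stable_step[OF W less.prems(2) ki(1,2) e(1) ki(4,5)])
      ultimately show ?thesis using less.hyps[of ?z "shift (k, i) e X"] ki by blast
    qed
  qed
qed

end

theorem theorem4p11:
  fixes n :: nat and G :: digraph and L R :: tableau
  assumes "n \<ge> 2"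
    and "relation_graph n G"
    and "realization n G L"
    and "R \<in> real_basis n G L"
  shows "cvec.independent (basis_vec ` gen_tableaux n G L R) \<and>
    cvec.span (basis_vec ` gen_tableaux n G L R) =
      uea_submodule n (real_basis n G L) (basis_vec R)"
proof -
  interpret relation_module n G L by unfold_locales (rule assms(2))
  let ?N = "gen_tableaux n G L R" and ?U = "uea_submodule n B (basis_vec R)"
  have R: "R \<in> ?N" using assms(4) by (simp add: gen_tableaux_def)
  have U_sub: "?U \<subseteq> {v. supp v \<subseteq> ?N}"
    unfolding uea_submodule_least
    by (rule Inter_lower) (use R gl_stable_gen_tableaux in auto)
  have "basis_vec S \<in> W" if S: "S \<in> ?N" and W: "gl_stable n B W" "basis_vec R \<in> W" for S W
  proof -
    \<comment> \<open>A stable subspace need not lie in the span of the basis tableaux, but this part of it does.\<close>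
    let ?W = "W \<inter> {v. supp v \<subseteq> ?N}"
    have "gl_stable n B ?W"
      by (rule gl_stable_Int[OF W(1) gl_stable_gen_tableaux])
    then have "basis_vec S \<in> ?W"
      using S W(2) R by (intro stable_contains[of ?W S R]) (auto simp: gen_tableaux_def)
    then show ?thesis by simp
  qed
  then have "basis_vec ` ?N \<subseteq> ?U" unfolding uea_submodule_least by blast
  moreover have "cvec.subspace ?U"
    unfolding uea_submodule_eq_span by (rule cvec.subspace_span)
  ultimately have "cvec.span (basis_vec ` ?N) \<subseteq> ?U" by (rule cvec.span_minimal)
  then show ?thesis using U_sub independent_basis_vec by (auto simp: span_basis_vec)
qed

end
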